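(* Let $p$ be an odd prime, $n\geqslant 1$, $0\leqslant k\leqslant n$, and let $e_{k+1},\ldots,e_n$ be non-negative integers with $e_i\neq e_j$ for $i\neq j$. Let $m\geqslant 1$, let $S=(s_1,\ldots,s_t)$ be a (possibly empty) sequence of integers with $0\leqslant s_1<\cdots<s_t<m$, and let $R=(r_1,\ldots,r_m)$ be a sequence of non-negative integers. Then $$St^{S,R}[k;e_{k+1},\ldots,e_n]=\begin{cases}(-1)^{t(k-t)}\,[k-t;s_1,\ldots,s_t,e_{k+1}+\Phi_J(k+1),\ldots,e_n+\Phi_J(n)], & \text{if } R=R_J \text{ for some } J,\\ 0, & \text{otherwise,}\end{cases}$$ where $J=(J_0,J_1,\ldots,J_m)$ ranges over the ordered decompositions $\{k+1,\ldots,n\}=\coprod_{s=0}^m J_s$ into pairwise disjoint (possibly empty) subsets, and $R_J$, $\Phi_J$ are as defined in the context. (The symbol $[k-t;\ldots]$ is read as $0$ if $t>k$.)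
   Context: All cohomology has coefficients in $\mathbb Z/p$. $H^*(B(\mathbb Z/p)^n)=E(x_1,\ldots,x_n)\otimes P(y_1,\ldots,y_n)$ with $\dim x_i=1$, $y_i=\beta x_i$ ($\beta$ the Bockstein), $E$ exterior and $P$ polynomial algebra over $\mathbb Z/p$. For non-negative integers $a_{k+1},\ldots,a_n$ ($0\leqslant k\leqslant n$), M\`ui's invariant $[k;a_{k+1},\ldots,a_n]$ is the "determinant" $\frac1{k!}\det$ of the $n\times n$ array whose first $k$ rows are $(x_1,\ldots,x_n)$ and whose remaining rows are $(y_1^{p^{a_j}},\ldots,y_n^{p^{a_j}})$, $j=k+1,\ldots,n$. Precisely, $$[k;a_{k+1},\ldots,a_n]=\sum_I \operatorname{sign}(\sigma_I)\,x_{i_1}\cdots x_{i_k}\,\det\big(y_{i_u}^{p^{a_v}}\big)_{k+1\leqslant u,v\leqslant n},$$ the sum over all $k$-element subsets $I=\{i_1<\cdots<i_k\}$ of $\{1,\ldots,n\}$ with complement $\{i_{k+1}<\cdots<i_n\}$, and $\sigma_I$ the permutation $j\mapsto i_j$. For $k=0$ this is $\det(y_i^{p^{a_j}})$. For $J=(J_0,\ldots,J_m)$ with $\coprod_{s=0}^mJ_s=\{k+1,\ldots,n\}$ set $r_{J_s}=\sum_{j\in J_s}p^{e_j}$ for $0\leqslant s\leqslant m$, $R_J=(r_{J_1},\ldots,r_{J_m})$, and define $\Phi_J:\{k+1,\ldots,n\}\to\{0,1,\ldots,m\}$ by $\Phi_J(i)=s$ if $i\in J_s$. Let $\mathcal A(p)$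 be the mod $p$ Steenrod algebra. Its dual is $\mathcal A(p)^*=E(\tau_0,\tau_1,\ldots)\otimes P(\xi_1,\xi_2,\ldots)$ (Milnor), $\dim\tau_s=2p^s-1$, $\dim\xi_i=2p^i-2$. It has the basis of monomials $\tau_S\xi^R=\tau_{s_1}\cdots\tau_{s_t}\xi_1^{r_1}\cdots\xi_m^{r_m}$, and $St^{S,R}\in\mathcal A(p)$ is the element of the dual basis dual to $\tau_S\xi^R$; in particular $St^{\emptyset,(k)}=P^k$. The action (Milnor's sign convention) is determined as follows: the ring homomorphism $\lambda:H^*(B(\mathbb Z/p)^n)\to H^*(B(\mathbb Z/p)^n)\widehat\otimes\mathcal A(p)^*$ (graded tensor product with Koszul signs) given by $\lambda(x_i)=x_i\otimes1+\sum_{s\geqslant0}y_i^{p^s}\otimes\tau_s$, $\lambda(y_i)=\sum_{s\geqslant0}y_i^{p^s}\otimes\xi_s$ ($\xi_0=1$) satisfies $\lambda(u)=\sum_{S,R}(-1)^{t(\dim u-t)}St^{S,R}u\otimes\tau_S\xi^R$, where $t$ is the length of $S$. *)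

theory Defs
  imports
    "Berlekamp_Zassenhaus.Finite_Field"
    "Jordan_Normal_Form.Determinant"
    "HOL-Library.Poly_Mapping"
    "HOL-Library.FSet"
    "HOL-Library.Disjoint_Sets"
    "HOL-Combinatorics.Permutations"
begin

section \<open>Exterior algebras over a commutative ring\<close>

text \<open>
  The exterior algebra over a commutative ring on generators indexed by \<open>nat\<close> is the free module
  on the ordered monomials, one for each finite set of indices, with
  \<open>x\<^sub>I x\<^sub>J = \<plusminus> x\<^bsub>I \<union> J\<^esub>\<close> for disjoint \<open>I\<close>, \<open>J\<close> (the sign
  being that of the shuffle that sorts the concatenation) and \<open>x\<^sub>I x\<^sub>J = 0\<close> otherwise.
\<close>

definition splits :: "nat fset \<Rightarrow> (nat fset \<times> nat fset) set" where
  "splits K = {(I, J). I |\<union>| J = K \<and> I |\<inter>| J = {||}}"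

definition shuffle_sign :: "nat fset \<Rightarrow> nat fset \<Rightarrow> 'a::ring_1" where
  "shuffle_sign I J = (- 1) ^ card {(i, j). i |\<in>| I \<and> j |\<in>| J \<and> j < i}"

lemma finite_splits [simp, intro]: "finite (splits K)"
proof (rule finite_subset)
  show "splits K \<subseteq> fset (fPow K) \<times> fset (fPow K)"
    by (auto simp: splits_def)
qed auto

typedef (overloaded) 'a ext = "{f :: nat fset \<Rightarrow> 'a::zero. finite {I. f I \<noteq> 0}}"
  morphisms ext_coeff Abs_ext
  by (rule exI[of _ "\<lambda>_. 0"]) auto

setup_lifting type_definition_ext

lemma finite_ext_supp [simp, intro]: "finite {I. ext_coeff f I \<noteq> 0}"
  by transfer

lemma ext_eqI: "(\<And>I. ext_coeff f I = ext_coeff g I) \<Longrightarrow> f = g"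
  by transfer auto

instantiation ext :: (ab_group_add) ab_group_add
begin

lift_definition zero_ext :: "'a ext" is "\<lambda>_. 0" by simp

lift_definition plus_ext :: "'a ext \<Rightarrow> 'a ext \<Rightarrow> 'a ext" is "\<lambda>f g I. f I + g I"
  subgoal for f g by (rule finite_subset[of _ "{I. f I \<noteq> 0} \<union> {I. g I \<noteq> 0}"]) auto
  done

lift_definition uminus_ext :: "'a ext \<Rightarrow> 'a ext" is "\<lambda>f I. - f I" by simp

lift_definition minus_ext :: "'a ext \<Rightarrow> 'a ext \<Rightarrow> 'a ext" is "\<lambda>f g I. f I - g I"
  subgoal for f g by (rule finite_subset[of _ "{I. f I \<noteq> 0} \<union> {I. g I \<noteq> 0}"]) auto
  done

instance by standard (transfer; auto simp: fun_eq_iff)+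

end

lemma ext_coeff_0 [simp]: "ext_coeff 0 I = 0" by transfer simp
lemma ext_coeff_add [simp]: "ext_coeff (f + g) I = ext_coeff f I + ext_coeff g I" by transfer simp
lemma ext_coeff_uminus [simp]: "ext_coeff (- f) I = - ext_coeff f I" by transfer simp
lemma ext_coeff_minus [simp]: "ext_coeff (f - g) I = ext_coeff f I - ext_coeff g I" by transfer simp
lemma ext_coeff_sum [simp]: "ext_coeff (sum h A) I = (\<Sum>a\<in>A. ext_coeff (h a) I)"
  by (induction A rule: infinite_finite_induct) auto

lemma splits_empty [simp]: "splits {||} = {({||}, {||})}"
  by (auto simp: splits_def)

lemma finite_inv [simp, intro]: "finite {(i, j). i |\<in>| A \<and> j |\<in>| B \<and> j < (i::nat)}"
  by (rule finite_subset[of _ "fset A \<times> fset B"]) auto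

lemma card_inv_un_left:
  assumes "I |\<inter>| J = {||}"
  shows "card {(i, j). i |\<in>| I |\<union>| J \<and> j |\<in>| K \<and> j < i} =
    card {(i, j). i |\<in>| I \<and> j |\<in>| K \<and> j < (i::nat)} + card {(i, j). i |\<in>| J \<and> j |\<in>| K \<and> j < i}"
    (is "card ?A = card ?B + card ?C")
proof -
  have "?A = ?B \<union> ?C" by auto
  moreover have "?B \<inter> ?C = {}" using assms by blast
  ultimately show ?thesis by (simp add: card_Un_disjoint[OF finite_inv finite_inv])
qed

lemma card_inv_un_right:
  assumes "I |\<inter>| J = {||}"
  shows "card {(i, j). i |\<in>| K \<and> j |\<in>| I |\<union>| J \<and> j < i} =
    card {(i, j). i |\<in>| K \<and> j |\<in>| I \<and> j < (i::nat)} + card {(i, j). i |\<in>| K \<and> j |\<in>| J \<and> j < i}"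
    (is "card ?A = card ?B + card ?C")
proof -
  have "?A = ?B \<union> ?C" by auto
  moreover have "?B \<inter> ?C = {}" using assms by blast
  ultimately show ?thesis by (simp add: card_Un_disjoint[OF finite_inv finite_inv])
qed

lemma shuffle_sign_un_left:
  "I |\<inter>| J = {||} \<Longrightarrow> shuffle_sign (I |\<union>| J) K = shuffle_sign I K * shuffle_sign J K"
  unfolding shuffle_sign_def by (subst card_inv_un_left) (auto simp: power_add)

lemma shuffle_sign_un_right:
  "I |\<inter>| J = {||} \<Longrightarrow> shuffle_sign K (I |\<union>| J) = shuffle_sign K I * shuffle_sign K J"
  unfolding shuffle_sign_def by (subst card_inv_un_right) (auto simp: power_add)

lemma shuffle_sign_empty [simp]: "shuffle_sign {||} J = 1" "shuffle_sign I {||} = 1"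
  by (auto simp: shuffle_sign_def)

lemma sum_pair_cong:
  assumes "\<And>a b. (a, b) \<in> X \<Longrightarrow> f a b = g a b"
  shows "(\<Sum>(a, b)\<in>X. f a b) = (\<Sum>(a, b)\<in>X. g a b)"
  using assms by (intro sum.cong) auto

lemma splits_assoc1:
  "(A, B) \<in> splits M \<Longrightarrow> (C, D) \<in> splits A \<Longrightarrow> (C, D |\<union>| B) \<in> splits M \<and> (D, B) \<in> splits (D |\<union>| B)"
  by (simp add: splits_def inf_sup_distrib1 inf_sup_distrib2)
     (elim conjE, hypsubst, simp add: sup_assoc inf_sup_distrib2)

lemma splits_assoc2:
  "(C, E) \<in> splits M \<Longrightarrow> (D, B) \<in> splits E \<Longrightarrow> (C |\<union>| D, B) \<in> splits M \<and> (C, D) \<in> splits (C |\<union>| D)"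
  by (simp add: splits_def inf_sup_distrib1 inf_sup_distrib2)
     (elim conjE, hypsubst, simp add: sup_assoc inf_sup_distrib1)

lemma splits_un: "(A, B) \<in> splits M \<Longrightarrow> A |\<union>| B = M"
  by (simp add: splits_def)

lemma sum_splits_assoc:
  "(\<Sum>(A, B)\<in>splits M. \<Sum>(C, D)\<in>splits A. h C D B) =
   (\<Sum>(C, E)\<in>splits M. \<Sum>(D, B)\<in>splits E. h C D B)"
proof -
  have "(\<Sum>(A, B)\<in>splits M. \<Sum>(C, D)\<in>splits A. h C D B) =
      (\<Sum>(z, w)\<in>(SIGMA z:splits M. splits (fst z)). h (fst w) (snd w) (snd z))"
    by (subst sum.Sigma[symmetric]) (simp_all add: case_prod_unfold)
  also have "\<dots> = (\<Sum>(z, w)\<in>(SIGMA z:splits M. splits (snd z)). h (fst z) (fst w) (snd w))"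
  proof (rule sum.reindex_bij_witness[of _
          "\<lambda>(z, w). ((fst z |\<union>| fst w, snd w), (fst z, fst w))"
          "\<lambda>(z, w). ((fst w, snd w |\<union>| snd z), (snd w, snd z))"], goal_cases)
    case (1 a) thus ?case by (clarsimp simp: splits_def)
  next
    case (2 a) thus ?case using splits_assoc1 by force
  next
    case (3 a) thus ?case by (clarsimp simp: splits_def)
  next
    case (4 a) thus ?case using splits_assoc2 by force
  next
    case (5 a) thus ?case by (auto simp: case_prod_unfold)
  qed
  also have "\<dots> = (\<Sum>(C, E)\<in>splits M. \<Sum>(D, B)\<in>splits E. h C D B)"
    by (subst sum.Sigma[symmetric]) (simp_all add: case_prod_unfold)
  finally show ?thesis .
qed

lemma sum_splits_swap: "(\<Sum>(A, B)\<in>splits M. h A B) = (\<Sum>(A, B)\<in>splits M. h B A)"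
  by (rule sum.reindex_bij_witness[of _ prod.swap prod.swap]) (auto simp: splits_def)

lemma sum_splits_1: "(\<And>A B. A \<noteq> {||} \<Longrightarrow> h A B = 0) \<Longrightarrow> (\<Sum>(A, B)\<in>splits M. h A B) = h {||} M"
  by (subst sum.mono_neutral_right[of _ "{({||}, M)}"], simp) (auto simp: splits_def)

lemma sum_splits_2: "(\<And>A B. B \<noteq> {||} \<Longrightarrow> h A B = 0) \<Longrightarrow> (\<Sum>(A, B)\<in>splits M. h A B) = h M {||}"
  by (subst sum.mono_neutral_right[of _ "{(M, {||})}"], simp) (auto simp: splits_def)

instantiation ext :: (comm_ring_1) ring_1
begin

lift_definition one_ext :: "'a ext" is "\<lambda>I. if I = {||} then 1 else 0" by simp

lift_definition times_ext :: "'a ext \<Rightarrow> 'a ext \<Rightarrow> 'a ext" is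
  "\<lambda>f g K. \<Sum>(I, J)\<in>splits K. shuffle_sign I J * f I * g J"
proof -
  fix f g :: "nat fset \<Rightarrow> 'a"
  assume fin: "finite {I. f I \<noteq> 0}" "finite {I. g I \<noteq> 0}"
  show "finite {K. (\<Sum>(I, J)\<in>splits K. shuffle_sign I J * f I * g J) \<noteq> 0}"
  proof (rule finite_subset)
    show "finite ((\<lambda>(I, J). I |\<union>| J) ` ({I. f I \<noteq> 0} \<times> {I. g I \<noteq> 0}))"
      using fin by auto
    show "{K. (\<Sum>(I, J)\<in>splits K. shuffle_sign I J * f I * g J) \<noteq> 0} \<subseteq>
      (\<lambda>(I, J). I |\<union>| J) ` ({I. f I \<noteq> 0} \<times> {I. g I \<noteq> 0})"
    proof
      fix K assume "K \<in> {K. (\<Sum>(I, J)\<in>splits K. shuffle_sign I J * f I * g J) \<noteq> 0}"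
      then obtain I J where "(I, J) \<in> splits K" "shuffle_sign I J * f I * g J \<noteq> 0"
        by (force elim: sum.not_neutral_contains_not_neutral)
      thus "K \<in> (\<lambda>(I, J). I |\<union>| J) ` ({I. f I \<noteq> 0} \<times> {I. g I \<noteq> 0})"
        by (force simp: splits_def)
    qed
  qed
qed

instance
proof
  fix f g h :: "'a ext"
  show "f * g * h = f * (g * h)"
  proof (rule ext_eqI)
    fix M
    have "ext_coeff (f * g * h) M = (\<Sum>(A, B)\<in>splits M. \<Sum>(C, D)\<in>splits A.
        shuffle_sign A B * (shuffle_sign C D * ext_coeff f C * ext_coeff g D) * ext_coeff h B)"
      by (simp add: times_ext.rep_eq sum_distrib_left sum_distrib_right case_prod_unfold)
    also have "\<dots> = (\<Sum>(A, B)\<in>splits M. \<Sum>(C, D)\<in>splits A. shuffle_sign C B * shuffle_sign D B *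
        shuffle_sign C D * ext_coeff f C * ext_coeff g D * ext_coeff h B)"
      by (intro sum_pair_cong) (auto simp: splits_def shuffle_sign_un_left mult_ac)
    also have "\<dots> = (\<Sum>(C, E)\<in>splits M. \<Sum>(D, B)\<in>splits E. shuffle_sign C B * shuffle_sign D B *
        shuffle_sign C D * ext_coeff f C * ext_coeff g D * ext_coeff h B)"
      by (rule sum_splits_assoc)
    also have "\<dots> = (\<Sum>(C, E)\<in>splits M. \<Sum>(D, B)\<in>splits E.
        shuffle_sign C E * ext_coeff f C * (shuffle_sign D B * ext_coeff g D * ext_coeff h B))"
      by (intro sum_pair_cong) (auto simp: splits_def shuffle_sign_un_right mult_ac)
    also have "\<dots> = ext_coeff (f * (g * h)) M"
      by (simp add: times_ext.rep_eq sum_distrib_left sum_distrib_right case_prod_unfold)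
    finally show "ext_coeff (f * g * h) M = ext_coeff (f * (g * h)) M" .
  qed
  show "1 * f = f"
    by (rule ext_eqI) (simp add: times_ext.rep_eq one_ext.rep_eq sum_splits_1)
  show "f * 1 = f"
    by (rule ext_eqI) (simp add: times_ext.rep_eq one_ext.rep_eq sum_splits_2)
  show "(f + g) * h = f * h + g * h"
    by (rule ext_eqI) (simp add: times_ext.rep_eq case_prod_unfold algebra_simps sum.distrib)
  show "f * (g + h) = f * g + f * h"
    by (rule ext_eqI) (simp add: times_ext.rep_eq case_prod_unfold algebra_simps sum.distrib)
  show "(0::'a ext) \<noteq> 1"
  proof
    assume "(0::'a ext) = 1"
    hence "ext_coeff (0::'a ext) {||} = ext_coeff 1 {||}" by simp
    thus False by (simp add: one_ext.rep_eq)
  qed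
qed

end

lemma ext_coeff_1: "ext_coeff 1 I = (if I = {||} then 1 else 0)"
  by (simp add: one_ext.rep_eq)


lift_definition ext_monom :: "'a::zero \<Rightarrow> nat fset \<Rightarrow> 'a ext" is "\<lambda>c I J. if J = I then c else 0"
  by simp

text \<open>The automorphism acting on the exterior monomial \<open>x\<^sub>I\<close> by \<open>(-1)\<^bsup>m |I|\<^esup>\<close>,
  i.e. by the Koszul sign for moving past an element of degree \<open>m\<close>.\<close>

lift_definition twist :: "nat \<Rightarrow> 'a::comm_ring_1 ext \<Rightarrow> 'a ext" is
  "\<lambda>m f I. (- 1) ^ (m * fcard I) * f I"
  subgoal for m f by (rule finite_subset[of _ "{I. f I \<noteq> 0}"]) auto
  done

lemma ext_coeff_twist: "ext_coeff (twist m f) I = (- 1) ^ (m * fcard I) * ext_coeff f I"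
  by (simp add: twist.rep_eq)

lemma twist_0_left [simp]: "twist 0 f = f"
  by (rule ext_eqI) (simp add: ext_coeff_twist)

lemma twist_0 [simp]: "twist m 0 = 0"
  by (rule ext_eqI) (simp add: ext_coeff_twist)

lemma twist_1 [simp]: "twist m 1 = 1"
  by (rule ext_eqI) (auto simp: ext_coeff_twist ext_coeff_1 fcard_fempty)

lemma twist_add: "twist m (f + g) = twist m f + twist m g"
  by (rule ext_eqI) (simp add: ext_coeff_twist algebra_simps)

lemma twist_sum: "twist m (sum f A) = (\<Sum>a\<in>A. twist m (f a))"
  by (induction A rule: infinite_finite_induct) (auto simp: twist_add)

lemma twist_twist: "twist m (twist n f) = twist (m + n) f"
  by (rule ext_eqI) (simp add: ext_coeff_twist algebra_simps power_add)

lemma twist_mult: "twist m (f * g) = twist m f * twist m g"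
proof (rule ext_eqI)
  fix K
  show "ext_coeff (twist m (f * g)) K = ext_coeff (twist m f * twist m g) K"
    unfolding ext_coeff_twist times_ext.rep_eq sum_distrib_left case_prod_unfold
    by (intro sum.cong refl)
       (auto simp: splits_def funion_fsubset_iff fcard_funion_fsubset fcard_funion_disjoint
          power_add algebra_simps)
qed

lemma twist_shuffle_sign: "twist m (shuffle_sign A B * f) = shuffle_sign A B * twist m f"
proof -
  have minus: "twist m (- f) = - twist m f"
    by (rule ext_eqI) (simp add: ext_coeff_twist)
  have "twist m ((-1) ^ k * f) = (-1) ^ k * twist m f" for k
    by (cases "even k") (simp_all add: minus)
  thus ?thesis by (simp add: shuffle_sign_def)
qed

section \<open>The completed tensor product\<close>

definition poly_splits :: "(nat \<Rightarrow>\<^sub>0 nat) \<Rightarrow> ((nat \<Rightarrow>\<^sub>0 nat) \<times> (nat \<Rightarrow>\<^sub>0 nat)) set" where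
  "poly_splits R = {(a, b). a + b = R}"

lemma finite_poly_splits [simp, intro]: "finite (poly_splits R)"
proof -
  define K where "K = Poly_Mapping.keys R"
  define N where "N = Max (Poly_Mapping.lookup R ` K)"
  define A where "A = {f. \<forall>i. (i \<in> K \<longrightarrow> f i \<in> {..N}) \<and> (i \<notin> K \<longrightarrow> f i = (0::nat))}"
  have [simp]: "finite K" by (simp add: K_def)
  have "finite A"
    unfolding A_def by (rule finite_set_of_finite_funs) auto
  moreover have "inj (Poly_Mapping.lookup :: (nat \<Rightarrow>\<^sub>0 nat) \<Rightarrow> _)"
    by (rule injI) (rule poly_mapping_eqI, simp)
  ultimately have fin: "finite (Poly_Mapping.lookup -` A)"
    by (rule finite_vimageI)
  have "(a, b) \<in> (\<lambda>a. (a, R - a)) ` (Poly_Mapping.lookup -` A)" if *: "a + b = R" for a b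
  proof (rule image_eqI)
    show "(a, b) = (a, R - a)" using * by auto
    have "Poly_Mapping.lookup a i \<le> N" if "i \<in> K" for i
    proof -
      have "Poly_Mapping.lookup a i \<le> Poly_Mapping.lookup R i"
        unfolding *[symmetric] by (simp add: lookup_add)
      also have "\<dots> \<le> N" unfolding N_def using that by (intro Max_ge) auto
      finally show ?thesis .
    qed
    moreover have "Poly_Mapping.lookup a i = 0" if "i \<notin> K" for i
      using that unfolding K_def *[symmetric] by (simp add: in_keys_iff lookup_add)
    ultimately show "a \<in> Poly_Mapping.lookup -` A" by (auto simp: A_def)
  qed
  hence "{(a, b). a + b = R} \<subseteq> (\<lambda>a. (a, R - a)) ` (Poly_Mapping.lookup -` A)" by auto
  hence "finite {(a, b). a + b = R}" using fin finite_subset by blast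
  thus ?thesis by (simp add: poly_splits_def)
qed


lemma sum_poly_splits_assoc:
  "(\<Sum>(A, B)\<in>poly_splits M. \<Sum>(C, D)\<in>poly_splits A. h C D B) =
   (\<Sum>(C, E)\<in>poly_splits M. \<Sum>(D, B)\<in>poly_splits E. h C D B)"
proof -
  have "(\<Sum>(A, B)\<in>poly_splits M. \<Sum>(C, D)\<in>poly_splits A. h C D B) =
      (\<Sum>(z, w)\<in>(SIGMA z:poly_splits M. poly_splits (fst z)). h (fst w) (snd w) (snd z))"
    by (subst sum.Sigma[symmetric]) (simp_all add: case_prod_unfold)
  also have "\<dots> = (\<Sum>(z, w)\<in>(SIGMA z:poly_splits M. poly_splits (snd z)). h (fst z) (fst w) (snd w))"
    by (rule sum.reindex_bij_witness[of _
          "\<lambda>(z, w). ((fst z + fst w, snd w), (fst z, fst w))"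
          "\<lambda>(z, w). ((fst w, snd w + snd z), (snd w, snd z))"])
       (auto simp: poly_splits_def algebra_simps)
  also have "\<dots> = (\<Sum>(C, E)\<in>poly_splits M. \<Sum>(D, B)\<in>poly_splits E. h C D B)"
    by (subst sum.Sigma[symmetric]) (simp_all add: case_prod_unfold)
  finally show ?thesis .
qed

lemma sum_poly_splits_swap:
  "(\<Sum>(A, B)\<in>poly_splits M. h A B) = (\<Sum>(A, B)\<in>poly_splits M. h B A)"
  by (rule sum.reindex_bij_witness[of _ prod.swap prod.swap]) (auto simp: poly_splits_def add.commute)

lemma sum_poly_splits_1:
  "(\<And>A B. A \<noteq> 0 \<Longrightarrow> h A B = 0) \<Longrightarrow> (\<Sum>(A, B)\<in>poly_splits M. h A B) = h 0 M"
  by (subst sum.mono_neutral_right[of _ "{(0, M)}"], simp) (auto simp: poly_splits_def, blast)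

lemma sum_poly_splits_2:
  "(\<And>A B. B \<noteq> 0 \<Longrightarrow> h A B = 0) \<Longrightarrow> (\<Sum>(A, B)\<in>poly_splits M. h A B) = h M 0"
  by (subst sum.mono_neutral_right[of _ "{(M, 0)}"], simp) (auto simp: poly_splits_def, blast)

text \<open>
  An element of \<open>H \<otimes> A*\<close>, completed, is a formal sum of \<open>h\<^bsub>S,R\<^esub> \<otimes> \<tau>\<^sub>S\<xi>\<^sup>R\<close>
  over all pairs \<open>S\<close>, \<open>R\<close>, with \<open>H\<close> of the form \<open>'a ext\<close>. In the product, moving
  \<open>\<tau>\<^sub>S\<xi>\<^sup>R\<close> past \<open>h\<close> costs the Koszul sign, which depends only on the parity of the
  number of elements of \<open>S\<close> because every \<open>\<tau>\<^sub>s\<close> is odd and every \<open>\<xi>\<^sub>i\<close> is even.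
\<close>

typedef (overloaded) 'a ctens = "UNIV :: (nat fset \<Rightarrow> (nat \<Rightarrow>\<^sub>0 nat) \<Rightarrow> 'a::zero ext) set"
  morphisms ct_coeff Abs_ctens
  by simp

setup_lifting type_definition_ctens

lemma ctens_eqI: "(\<And>S R. ct_coeff F S R = ct_coeff G S R) \<Longrightarrow> F = G"
  by transfer auto

lemma ct_coeff_Abs [simp]: "ct_coeff (Abs_ctens f) = f"
  by (simp add: Abs_ctens_inverse)

instantiation ctens :: (ab_group_add) ab_group_add
begin

lift_definition zero_ctens :: "'a ctens" is "\<lambda>_ _. 0" .

lift_definition plus_ctens :: "'a ctens \<Rightarrow> 'a ctens \<Rightarrow> 'a ctens" is "\<lambda>F G S R. F S R + G S R" .

lift_definition uminus_ctens :: "'a ctens \<Rightarrow> 'a ctens" is "\<lambda>F S R. - F S R" .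

lift_definition minus_ctens :: "'a ctens \<Rightarrow> 'a ctens \<Rightarrow> 'a ctens" is "\<lambda>F G S R. F S R - G S R" .

instance by standard (transfer; auto simp: fun_eq_iff)+

end

lemma ct_coeff_0 [simp]: "ct_coeff 0 S R = 0" by transfer simp
lemma ct_coeff_add [simp]: "ct_coeff (F + G) S R = ct_coeff F S R + ct_coeff G S R" by transfer simp
lemma ct_coeff_uminus [simp]: "ct_coeff (- F) S R = - ct_coeff F S R" by transfer simp
lemma ct_coeff_minus [simp]: "ct_coeff (F - G) S R = ct_coeff F S R - ct_coeff G S R" by transfer simp
lemma ct_coeff_sum [simp]: "ct_coeff (sum h A) S R = (\<Sum>a\<in>A. ct_coeff (h a) S R)"
  by (induction A rule: infinite_finite_induct) auto

lemma shuffle_sign_left_commute: "f * (shuffle_sign A B * g) = shuffle_sign A B * (f * g)"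
proof -
  have "f * ((-1) ^ k * g) = (-1) ^ k * (f * g)" for k
    by (cases "even k") simp_all
  thus ?thesis by (simp add: shuffle_sign_def)
qed

lemma splits_fcard: "(A, B) \<in> splits M \<Longrightarrow> fcard M = fcard A + fcard B"
  by (auto simp: splits_def fcard_funion_disjoint)

instantiation ctens :: (comm_ring_1) ring_1
begin

lift_definition one_ctens :: "'a ctens" is "\<lambda>S R. if S = {||} \<and> R = 0 then 1 else 0" .

lift_definition times_ctens :: "'a ctens \<Rightarrow> 'a ctens \<Rightarrow> 'a ctens" is
  "\<lambda>F G S R. \<Sum>(S1, S2)\<in>splits S. \<Sum>(R1, R2)\<in>poly_splits R.
     shuffle_sign S1 S2 * F S1 R1 * twist (fcard S1) (G S2 R2)" .

instance
proof
  fix F G K :: "'a ctens"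
  show "F * G * K = F * (G * K)"
  proof (rule ctens_eqI)
    fix S R
    let ?f = "ct_coeff F" and ?g = "ct_coeff G" and ?k = "ct_coeff K"
    define h where "h C D B P1 P2 Q = shuffle_sign C B * shuffle_sign D B * shuffle_sign C D *
      (?f C P1 * twist (fcard C) (?g D P2) * twist (fcard C + fcard D) (?k B Q))" for C D B P1 P2 Q
    have "ct_coeff (F * G * K) S R = (\<Sum>(A, B)\<in>splits S. \<Sum>(P, Q)\<in>poly_splits R.
        \<Sum>(C, D)\<in>splits A. \<Sum>(P1, P2)\<in>poly_splits P.
        shuffle_sign A B * (shuffle_sign C D * ?f C P1 * twist (fcard C) (?g D P2)) * twist (fcard A) (?k B Q))"
      by (simp add: times_ctens.rep_eq sum_distrib_left sum_distrib_right case_prod_unfold)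
    also have "\<dots> = (\<Sum>(A, B)\<in>splits S. \<Sum>(P, Q)\<in>poly_splits R.
        \<Sum>(C, D)\<in>splits A. \<Sum>(P1, P2)\<in>poly_splits P. h C D B P1 P2 Q)"
    proof (intro sum_pair_cong)
      fix A B P Q C D P1 P2
      assume *: "(A, B) \<in> splits S" "(C, D) \<in> splits A"
      have "fcard A = fcard C + fcard D" using *(2) by (rule splits_fcard)
      moreover have "shuffle_sign A B = (shuffle_sign C B * shuffle_sign D B :: 'a ext)"
        using *(2) by (auto simp: splits_def shuffle_sign_un_left)
      ultimately show "shuffle_sign A B * (shuffle_sign C D * ?f C P1 * twist (fcard C) (?g D P2)) *
          twist (fcard A) (?k B Q) = h C D B P1 P2 Q"
        by (simp add: h_def mult.assoc)
    qed
    also have "\<dots> = (\<Sum>(A, B)\<in>splits S. \<Sum>(C, D)\<in>splits A. \<Sum>(P, Q)\<in>poly_splits R.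
        \<Sum>(P1, P2)\<in>poly_splits P. h C D B P1 P2 Q)"
      unfolding case_prod_unfold by (intro sum.cong refl) (rule sum.swap)
    also have "\<dots> = (\<Sum>(C, E)\<in>splits S. \<Sum>(D, B)\<in>splits E. \<Sum>(P, Q)\<in>poly_splits R.
        \<Sum>(P1, P2)\<in>poly_splits P. h C D B P1 P2 Q)"
      by (rule sum_splits_assoc)
    also have "\<dots> = (\<Sum>(C, E)\<in>splits S. \<Sum>(D, B)\<in>splits E. \<Sum>(P1, Q)\<in>poly_splits R.
        \<Sum>(P2, P)\<in>poly_splits Q. h C D B P1 P2 P)"
      by (intro sum_pair_cong sum_poly_splits_assoc)
    also have "\<dots> = (\<Sum>(C, E)\<in>splits S. \<Sum>(P1, Q)\<in>poly_splits R. \<Sum>(D, B)\<in>splits E.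
        \<Sum>(P2, P)\<in>poly_splits Q. h C D B P1 P2 P)"
      unfolding case_prod_unfold by (intro sum.cong refl) (rule sum.swap)
    also have "\<dots> = (\<Sum>(C, E)\<in>splits S. \<Sum>(P1, Q)\<in>poly_splits R. \<Sum>(D, B)\<in>splits E.
        \<Sum>(P2, P)\<in>poly_splits Q. shuffle_sign C E * ?f C P1 *
        twist (fcard C) (shuffle_sign D B * ?g D P2 * twist (fcard D) (?k B P)))"
    proof (intro sum_pair_cong)
      fix C E P1 Q D B P2 P
      assume *: "(C, E) \<in> splits S" "(D, B) \<in> splits E"
      have 1: "shuffle_sign C E = (shuffle_sign C D * shuffle_sign C B :: 'a ext)"
        using *(2) by (auto simp: splits_def shuffle_sign_un_right)
      show "h C D B P1 P2 P = shuffle_sign C E * ?f C P1 *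
        twist (fcard C) (shuffle_sign D B * ?g D P2 * twist (fcard D) (?k B P))"
        unfolding h_def 1 mult.assoc unfolding twist_shuffle_sign unfolding twist_mult twist_twist
        by (simp only: shuffle_sign_left_commute[of "?f C P1"]
            shuffle_sign_left_commute[of "shuffle_sign D B" C D]
            shuffle_sign_left_commute[of "shuffle_sign C B" C D])
    qed
    also have "\<dots> = ct_coeff (F * (G * K)) S R"
      by (simp add: times_ctens.rep_eq sum_distrib_left sum_distrib_right twist_sum case_prod_unfold)
    finally show "ct_coeff (F * G * K) S R = ct_coeff (F * (G * K)) S R" .
  qed
  show "1 * F = F"
  proof (rule ctens_eqI)
    fix S R
    have "ct_coeff (1 * F) S R = (\<Sum>(S1, S2)\<in>splits S. \<Sum>(R1, R2)\<in>poly_splits R.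
        shuffle_sign S1 S2 * (if S1 = {||} \<and> R1 = 0 then 1 else 0) * twist (fcard S1) (ct_coeff F S2 R2))"
      by (simp add: times_ctens.rep_eq one_ctens.rep_eq)
    also have "\<dots> = (\<Sum>(R1, R2)\<in>poly_splits R. (if R1 = 0 then 1 else 0) * ct_coeff F S R2)"
      by (subst sum_splits_1) (auto simp: fcard_fempty)
    also have "\<dots> = ct_coeff F S R"
      by (subst sum_poly_splits_1) auto
    finally show "ct_coeff (1 * F) S R = ct_coeff F S R" .
  qed
  show "F * 1 = F"
  proof (rule ctens_eqI)
    fix S R
    have "ct_coeff (F * 1) S R = (\<Sum>(S1, S2)\<in>splits S. \<Sum>(R1, R2)\<in>poly_splits R.
        shuffle_sign S1 S2 * ct_coeff F S1 R1 * twist (fcard S1) (if S2 = {||} \<and> R2 = 0 then 1 else 0))"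
      by (simp add: times_ctens.rep_eq one_ctens.rep_eq)
    also have "\<dots> = (\<Sum>(R1, R2)\<in>poly_splits R. ct_coeff F S R1 * twist (fcard S) (if R2 = 0 then 1 else 0))"
      by (subst sum_splits_2) auto
    also have "\<dots> = ct_coeff F S R"
      by (subst sum_poly_splits_2) auto
    finally show "ct_coeff (F * 1) S R = ct_coeff F S R" .
  qed
  show "(F + G) * K = F * K + G * K"
    by (rule ctens_eqI) (simp add: times_ctens.rep_eq case_prod_unfold algebra_simps sum.distrib)
  show "F * (G + K) = F * G + F * K"
    by (rule ctens_eqI) (simp add: times_ctens.rep_eq case_prod_unfold algebra_simps sum.distrib twist_add)
  show "(0::'a ctens) \<noteq> 1"
  proof
    assume "(0::'a ctens) = 1"
    hence "ct_coeff (0::'a ctens) {||} 0 = ct_coeff 1 {||} 0" by simp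
    thus False by (simp add: one_ctens.rep_eq)
  qed
qed

end

lemma ct_coeff_1: "ct_coeff 1 S R = (if S = {||} \<and> R = 0 then 1 else 0)"
  by (simp add: one_ctens.rep_eq)

lemma ext_coeff_shuffle_sign: "ext_coeff (shuffle_sign A B * f) I = shuffle_sign A B * ext_coeff f I"
proof -
  have "ext_coeff ((-1) ^ k * f) I = (-1) ^ k * ext_coeff f I" for k
    by (cases "even k") simp_all
  thus ?thesis by (simp add: shuffle_sign_def)
qed

lemma shuffle_sign_swap:
  assumes "(A, B) \<in> splits M"
  shows "shuffle_sign B A = (-1) ^ (fcard A * fcard B) * shuffle_sign A B"
proof -
  let ?I = "\<lambda>A B. {(i, j). i |\<in>| A \<and> j |\<in>| B \<and> j < (i::nat)}"
  have "fset A \<times> fset B = ?I A B \<union> prod.swap ` ?I B A"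
    using assms by (auto simp: splits_def image_iff)
  moreover have "?I A B \<inter> prod.swap ` ?I B A = {}" by auto
  ultimately have "card (fset A \<times> fset B) = card (?I A B) + card (prod.swap ` ?I B A)"
    by (simp add: card_Un_disjoint[OF finite_inv finite_imageI[OF finite_inv]])
  moreover have "card (prod.swap ` ?I B A) = card (?I B A)"
    by (rule card_image) (auto intro: inj_onI)
  ultimately have "fcard A * fcard B = card (?I A B) + card (?I B A)"
    by (simp only: fcard.rep_eq card_cartesian_product)
  hence "even (fcard A * fcard B) \<longleftrightarrow> (even (card (?I A B)) \<longleftrightarrow> even (card (?I B A)))"
    by (simp only: even_add)
  thus ?thesis by (auto simp: shuffle_sign_def minus_one_power_iff)
qed

lemma ctens_commute_aux:
  assumes "\<And>S1 R1 I1 S2 R2 I2. ext_coeff (ct_coeff F S1 R1) I1 \<noteq> 0 \<Longrightarrow> ext_coeff (ct_coeff G S2 R2) I2 \<noteq> 0 \<Longrightarrow>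
      even ((fcard S1 + fcard I1) * (fcard S2 + fcard I2) + c)"
  shows "F * G = (-1) ^ c * (G * F)"
proof (rule ctens_eqI, rule ext_eqI)
  fix S R I
  let ?f = "\<lambda>S R. ext_coeff (ct_coeff F S R)" and ?g = "\<lambda>S R. ext_coeff (ct_coeff G S R)"
  have expand: "ext_coeff (ct_coeff (F * G) S R) I = (\<Sum>(S1, S2)\<in>splits S. \<Sum>(R1, R2)\<in>poly_splits R.
      \<Sum>(I1, I2)\<in>splits I. shuffle_sign S1 S2 * (shuffle_sign I1 I2 * ext_coeff (ct_coeff F S1 R1) I1 *
      ((-1) ^ (fcard S1 * fcard I2) * ext_coeff (ct_coeff G S2 R2) I2)))" for F G :: "'a ctens"
    by (simp add: times_ctens.rep_eq mult.assoc ext_coeff_shuffle_sign case_prod_unfold)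
       (simp add: times_ext.rep_eq ext_coeff_twist sum_distrib_left mult.assoc case_prod_unfold)
  have "ext_coeff (ct_coeff (F * G) S R) I = (\<Sum>(S1, S2)\<in>splits S. \<Sum>(R1, R2)\<in>poly_splits R.
      \<Sum>(I1, I2)\<in>splits I. (-1) ^ c * (shuffle_sign S2 S1 * (shuffle_sign I2 I1 * ?g S2 R2 I2 *
      ((-1) ^ (fcard S2 * fcard I1) * ?f S1 R1 I1))))"
    unfolding expand
  proof (intro sum_pair_cong)
    fix S1 S2 R1 R2 I1 I2
    assume *: "(S1, S2) \<in> splits S" "(I1, I2) \<in> splits I"
    show "shuffle_sign S1 S2 * (shuffle_sign I1 I2 * ?f S1 R1 I1 * ((-1) ^ (fcard S1 * fcard I2) * ?g S2 R2 I2)) =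
      (-1) ^ c * (shuffle_sign S2 S1 * (shuffle_sign I2 I1 * ?g S2 R2 I2 * ((-1) ^ (fcard S2 * fcard I1) * ?f S1 R1 I1)))"
    proof (cases "?f S1 R1 I1 = 0 \<or> ?g S2 R2 I2 = 0")
      case False
      hence ev: "even ((fcard S1 + fcard I1) * (fcard S2 + fcard I2) + c)" using assms by blast
      have "even (c + fcard S1 * fcard S2 + fcard I1 * fcard I2 + fcard S2 * fcard I1 + fcard S1 * fcard I2)"
        using ev by (simp add: algebra_simps)
      hence "(-1) ^ (c + fcard S1 * fcard S2 + fcard I1 * fcard I2 + fcard S2 * fcard I1) =
          ((-1) ^ (fcard S1 * fcard I2) :: 'a)"
        by (simp add: minus_one_power_iff)
      note sgn = this
      have "(-1) ^ c * (shuffle_sign S2 S1 * (shuffle_sign I2 I1 * ?g S2 R2 I2 * ((-1) ^ (fcard S2 * fcard I1) * ?f S1 R1 I1))) =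
        shuffle_sign S1 S2 * shuffle_sign I1 I2 * ?f S1 R1 I1 * ?g S2 R2 I2 *
        (-1) ^ (c + fcard S1 * fcard S2 + fcard I1 * fcard I2 + fcard S2 * fcard I1)"
        unfolding shuffle_sign_swap[OF *(1)] shuffle_sign_swap[OF *(2)] power_add by (simp only: mult_ac)
      thus ?thesis
        unfolding sgn by (simp only: mult_ac)
    qed auto
  qed
  also have "\<dots> = (-1) ^ c * ext_coeff (ct_coeff (G * F) S R) I"
    unfolding expand
    apply (subst sum_splits_swap)
    apply (subst sum_poly_splits_swap)
    apply (subst (2) sum_splits_swap)
    by (simp add: sum_distrib_left case_prod_unfold)
  also have "\<dots> = ext_coeff (ct_coeff ((-1) ^ c * (G * F)) S R) I"
    by (cases "even c") simp_all
  finally show "ext_coeff (ct_coeff (F * G) S R) I = ext_coeff (ct_coeff ((-1) ^ c * (G * F)) S R) I" .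
qed


section \<open>Free graded commutative algebras over the integers mod p\<close>

type_synonym 'p pol = "(nat \<Rightarrow>\<^sub>0 nat) \<Rightarrow>\<^sub>0 'p mod_ring"

text \<open>
  The algebra \<open>E \<otimes> P\<close> on exterior generators and polynomial generators indexed by \<open>nat\<close>,
  over the integers modulo \<open>CARD('p)\<close>, realised as the exterior algebra over \<open>P\<close>.
\<close>

type_synonym 'p gca = "'p pol ext"

definition gmonom :: "'p::prime_card mod_ring \<Rightarrow> nat fset \<Rightarrow> (nat \<Rightarrow>\<^sub>0 nat) \<Rightarrow> 'p gca" where
  "gmonom c I a = ext_monom (Poly_Mapping.single a c) I"

definition gcoeff :: "'p::prime_card gca \<Rightarrow> nat fset \<Rightarrow> (nat \<Rightarrow>\<^sub>0 nat) \<Rightarrow> 'p mod_ring" where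
  "gcoeff u I a = Poly_Mapping.lookup (ext_coeff u I) a"

definition gsupp :: "'p::prime_card gca \<Rightarrow> (nat fset \<times> (nat \<Rightarrow>\<^sub>0 nat)) set" where
  "gsupp u = {(I, a). gcoeff u I a \<noteq> 0}"

definition smul :: "'p::prime_card mod_ring \<Rightarrow> 'p gca \<Rightarrow> 'p gca" where
  "smul c u = gmonom c {||} 0 * u"

definition odd_gen :: "nat \<Rightarrow> 'p::prime_card gca" where
  "odd_gen i = gmonom 1 {|i|} 0"

definition even_gen :: "nat \<Rightarrow> 'p::prime_card gca" where
  "even_gen i = gmonom 1 {||} (Poly_Mapping.single i 1)"

subsection \<open>Cohomology of elementary abelian groups\<close>

text \<open>
  \<open>H*(B(\<int>/p)\<^sup>n)\<close> is the subalgebra of \<open>'p gca\<close> generated by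
  \<open>x\<^sub>1, \<dots>, x\<^sub>n, y\<^sub>1, \<dots>, y\<^sub>n\<close>. The coaction below treats each pair
  \<open>x\<^sub>i, y\<^sub>i\<close> by itself, so the further generators of the ambient algebra play no role.
\<close>

definition hx :: "nat \<Rightarrow> 'p::prime_card gca" where "hx i = odd_gen i"

definition hy :: "nat \<Rightarrow> 'p::prime_card gca" where "hy i = even_gen i"

definition hdim :: "nat fset \<Rightarrow> (nat \<Rightarrow>\<^sub>0 nat) \<Rightarrow> nat" where
  "hdim I a = fcard I + 2 * (\<Sum>i\<in>Poly_Mapping.keys a. Poly_Mapping.lookup a i)"

definition hcomp :: "nat \<Rightarrow> 'p::prime_card gca \<Rightarrow> 'p gca" where
  "hcomp d u = (\<Sum>(I, a)\<in>{(I, a)\<in>gsupp u. hdim I a = d}. gmonom (gcoeff u I a) I a)"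

subsection \<open>The dual Steenrod algebra and the coaction\<close>

definition tau :: "nat \<Rightarrow> 'p::prime_card gca" where "tau s = odd_gen s"

definition xi :: "nat \<Rightarrow> 'p::prime_card gca" where
  "xi s = (case s of 0 \<Rightarrow> 1 | Suc j \<Rightarrow> even_gen j)"

definition tens :: "'p::prime_card gca \<Rightarrow> 'p gca \<Rightarrow> 'p pol ctens" (infixl \<open>\<otimes>\<otimes>\<close> 72) where
  "h \<otimes>\<otimes> b = Abs_ctens (\<lambda>S R. smul (gcoeff b S R) h)"

text \<open>The sum of a family of which only finitely many members involve any given
  \<open>\<tau>\<^sub>S\<xi>\<^sup>R\<close>.\<close>

definition ct_suminf :: "(nat \<Rightarrow> 'p::prime_card pol ctens) \<Rightarrow> 'p pol ctens" where
  "ct_suminf F = Abs_ctens (\<lambda>S R. \<Sum>s | ct_coeff (F s) S R \<noteq> 0. ct_coeff (F s) S R)"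

definition coact_x :: "nat \<Rightarrow> 'p::prime_card pol ctens" where
  "coact_x i = hx i \<otimes>\<otimes> 1 + ct_suminf (\<lambda>s. hy i ^ (CARD('p) ^ s) \<otimes>\<otimes> tau s)"

definition coact_y :: "nat \<Rightarrow> 'p::prime_card pol ctens" where
  "coact_y i = ct_suminf (\<lambda>s. hy i ^ (CARD('p) ^ s) \<otimes>\<otimes> xi s)"

definition coaction :: "'p::prime_card gca \<Rightarrow> 'p pol ctens" where
  "coaction u = (\<Sum>(I, a)\<in>gsupp u. (gmonom (gcoeff u I a) {||} 0 \<otimes>\<otimes> 1) *
      prod_list (map coact_x (sorted_list_of_fset I)) *
      prod_list (map (\<lambda>i. coact_y i ^ Poly_Mapping.lookup a i) (sorted_list_of_set (Poly_Mapping.keys a))))"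

lemma finite_gsupp [simp, intro]: "finite (gsupp u)"
proof (rule finite_subset)
  show "gsupp u \<subseteq> (SIGMA I:{I. ext_coeff u I \<noteq> 0}. Poly_Mapping.keys (ext_coeff u I))"
    by (auto simp: gsupp_def gcoeff_def in_keys_iff)
qed auto

lemma gca_eqI: "(\<And>I a. gcoeff u I a = gcoeff v I a) \<Longrightarrow> u = v"
  by (rule ext_eqI, rule poly_mapping_eqI) (simp add: gcoeff_def)

lemma gcoeff_0 [simp]: "gcoeff 0 I a = 0" by (simp add: gcoeff_def)
lemma gcoeff_add [simp]: "gcoeff (u + v) I a = gcoeff u I a + gcoeff v I a"
  by (simp add: gcoeff_def lookup_add)
lemma gcoeff_sum [simp]: "gcoeff (sum h A) I a = (\<Sum>z\<in>A. gcoeff (h z) I a)"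
  by (simp add: gcoeff_def lookup_sum)
lemma gcoeff_gmonom: "gcoeff (gmonom c I a) J b = (if I = J \<and> a = b then c else 0)"
  by (auto simp: gcoeff_def gmonom_def ext_monom.rep_eq lookup_single when_def)
lemma one_eq_gmonom: "(1 :: 'p::prime_card gca) = gmonom 1 {||} 0"
  by (rule ext_eqI) (simp add: gmonom_def ext_coeff_1 ext_monom.rep_eq)
lemma gcoeff_1: "gcoeff 1 I a = (if I = {||} \<and> a = 0 then 1 else 0)"
  by (simp add: one_eq_gmonom gcoeff_gmonom)
lemma gmonom_0 [simp]: "gmonom 0 I a = 0"
  by (rule gca_eqI) (simp add: gcoeff_gmonom)
lemma gmonom_add: "gmonom (c + d) I a = gmonom c I a + gmonom d I a"
  by (rule gca_eqI) (simp add: gcoeff_gmonom)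

lemma gca_decomp:
  assumes "finite A" "gsupp u \<subseteq> A"
  shows "u = (\<Sum>(I, a)\<in>A. gmonom (gcoeff u I a) I a)"
proof (rule gca_eqI)
  fix J b
  have "gcoeff (\<Sum>(I, a)\<in>A. gmonom (gcoeff u I a) I a) J b =
      (\<Sum>z\<in>A. if z = (J, b) then gcoeff u J b else 0)"
    unfolding gcoeff_sum by (intro sum.cong refl) (simp add: gcoeff_gmonom case_prod_unfold prod_eq_iff cong: if_cong)
  also have "\<dots> = gcoeff u J b"
    using assms by (auto simp: gsupp_def)
  finally show "gcoeff u J b = gcoeff (\<Sum>(I, a)\<in>A. gmonom (gcoeff u I a) I a) J b" ..
qed

lemma shuffle_sign_single:
  "shuffle_sign I J * Poly_Mapping.single a c = Poly_Mapping.single a (shuffle_sign I J * c :: 'a::comm_ring_1)"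
proof -
  have "(-1) ^ k * Poly_Mapping.single a c = Poly_Mapping.single a ((-1) ^ k * c)" for k
    by (cases "even k") (simp_all add: single_uminus)
  thus ?thesis by (simp add: shuffle_sign_def)
qed

lemma gmonom_mult:
  "gmonom c I a * gmonom d J b =
    (if I |\<inter>| J = {||} then gmonom (shuffle_sign I J * c * d) (I |\<union>| J) (a + b) else 0)"
proof (rule ext_eqI)
  fix K
  have "ext_coeff (gmonom c I a * gmonom d J b) K =
    (\<Sum>z\<in>splits K. if z = (I, J) then Poly_Mapping.single (a + b) (shuffle_sign I J * c * d) else 0)"
    unfolding times_ext.rep_eq case_prod_unfold
    by (intro sum.cong refl)
       (auto simp: gmonom_def ext_monom.rep_eq shuffle_sign_single mult_single prod_eq_iff)
  also have "\<dots> = (if (I, J) \<in> splits K then Poly_Mapping.single (a + b) (shuffle_sign I J * c * d) else 0)"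
    by simp
  finally show "ext_coeff (gmonom c I a * gmonom d J b) K = ext_coeff
      (if I |\<inter>| J = {||} then gmonom (shuffle_sign I J * c * d) (I |\<union>| J) (a + b) else 0) K"
    by (auto simp: splits_def gmonom_def ext_monom.rep_eq)
qed

lemma ext_coeff_smul: "ext_coeff (smul c u) I = Poly_Mapping.single 0 c * ext_coeff u I"
  unfolding smul_def times_ext.rep_eq
  by (subst sum_splits_1) (auto simp: gmonom_def ext_monom.rep_eq)

lemma smul_0 [simp]: "smul 0 u = 0" "smul c 0 = 0" by (simp_all add: smul_def)
lemma smul_1 [simp]: "smul 1 u = u" by (simp add: smul_def flip: one_eq_gmonom)
lemma smul_smul: "smul c (smul d u) = smul (c * d) u"
  by (simp add: smul_def gmonom_mult flip: mult.assoc)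
lemma smul_add_left: "smul (c + d) u = smul c u + smul d u"
  by (simp add: smul_def gmonom_add algebra_simps)
lemma smul_gmonom: "smul c (gmonom d I a) = gmonom (c * d) I a"
  by (simp add: smul_def gmonom_mult)
lemma gcoeff_smul: "gcoeff (smul c u) I a = c * gcoeff u I a"
proof -
  have "gcoeff (smul c u) I a = gcoeff (\<Sum>(J, b)\<in>gsupp u. gmonom (c * gcoeff u J b) J b) I a"
    by (subst gca_decomp[of "gsupp u" u]) (auto simp: smul_def sum_distrib_left case_prod_unfold gmonom_mult)
  also have "\<dots> = (\<Sum>z\<in>gsupp u. if z = (I, a) then c * gcoeff u I a else 0)"
    unfolding gcoeff_sum by (intro sum.cong refl) (simp add: gcoeff_gmonom case_prod_unfold prod_eq_iff cong: if_cong)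
  also have "\<dots> = c * gcoeff u I a"
    by simp (simp add: gsupp_def)
  finally show ?thesis .
qed

lemma hy_power: "hy i ^ k = gmonom 1 {||} (Poly_Mapping.single i k)"
  by (induction k)
     (simp_all add: hy_def even_gen_def one_eq_gmonom gmonom_mult single_add[symmetric])

subsubsection \<open>The coaction is a ring homomorphism\<close>

definition ct_par :: "nat \<Rightarrow> 'p::prime_card pol ctens \<Rightarrow> bool" where
  "ct_par q F \<longleftrightarrow> (\<forall>S R I. ext_coeff (ct_coeff F S R) I \<noteq> 0 \<longrightarrow> even (fcard S + fcard I + q))"

lemma ct_par_add:
  assumes "ct_par q F" "ct_par q G"
  shows "ct_par q (F + G)"
  unfolding ct_par_def
proof (intro allI impI)
  fix S R I assume "ext_coeff (ct_coeff (F + G) S R) I \<noteq> 0"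
  hence "ext_coeff (ct_coeff F S R) I \<noteq> 0 \<or> ext_coeff (ct_coeff G S R) I \<noteq> 0" by auto
  thus "even (fcard S + fcard I + q)" using assms unfolding ct_par_def by blast
qed

lemma ct_par_suminf:
  assumes "\<And>s. ct_par q (F s)"
  shows "ct_par q (ct_suminf F)"
  unfolding ct_par_def
proof (intro allI impI)
  fix S R I assume "ext_coeff (ct_coeff (ct_suminf F) S R) I \<noteq> 0"
  hence "(\<Sum>s | ct_coeff (F s) S R \<noteq> 0. ext_coeff (ct_coeff (F s) S R) I) \<noteq> 0"
    by (simp add: ct_suminf_def)
  then obtain s where "ext_coeff (ct_coeff (F s) S R) I \<noteq> 0"
    by (rule sum.not_neutral_contains_not_neutral)
  thus "even (fcard S + fcard I + q)" using assms unfolding ct_par_def by blast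
qed

lemma ct_par_tens:
  assumes "\<And>S R. gcoeff b S R \<noteq> 0 \<Longrightarrow> fcard S = s" "\<And>I. ext_coeff h I \<noteq> 0 \<Longrightarrow> fcard I = t"
    "even (s + t + q)"
  shows "ct_par q (h \<otimes>\<otimes> b)"
  unfolding ct_par_def tens_def ct_coeff_Abs
proof (intro allI impI)
  fix S R I assume *: "ext_coeff (smul (gcoeff b S R) h) I \<noteq> 0"
  hence "gcoeff b S R \<noteq> 0" by auto
  moreover have "ext_coeff h I \<noteq> 0" using * by (auto simp: ext_coeff_smul)
  ultimately show "even (fcard S + fcard I + q)" using assms by metis
qed

lemma ext_coeff_gmonomD: "ext_coeff (gmonom c I a) J \<noteq> 0 \<Longrightarrow> J = I"
  by (auto simp: gmonom_def ext_monom.rep_eq split: if_splits)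

lemma gcoeff_gmonomD: "gcoeff (gmonom c I a) J b \<noteq> 0 \<Longrightarrow> J = I"
  by (auto simp: gcoeff_gmonom split: if_splits)

lemma ct_par_coact_x: "ct_par 1 (coact_x i)"
  unfolding coact_x_def
  by (intro ct_par_add ct_par_suminf)
     (auto simp: hx_def odd_gen_def tau_def hy_power one_eq_gmonom fcard_fempty fcard_finsert_if
       dest!: ext_coeff_gmonomD gcoeff_gmonomD intro!: ct_par_tens)

lemma ct_par_coact_y: "ct_par 0 (coact_y i)"
  unfolding coact_y_def
  by (intro ct_par_suminf)
     (auto simp: xi_def even_gen_def hy_power one_eq_gmonom fcard_fempty split: nat.splits
       dest!: ext_coeff_gmonomD gcoeff_gmonomD intro!: ct_par_tens)

lemma coact_y_central: "coact_y i * F = F * coact_y i"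
proof -
  have "coact_y i * F = (-1) ^ 0 * (F * coact_y i)"
  proof (rule ctens_commute_aux)
    fix S1 R1 I1 S2 R2 I2
    assume "ext_coeff (ct_coeff (coact_y i) S1 R1) I1 \<noteq> 0"
    hence "even (fcard S1 + fcard I1 + 0)"
      using ct_par_coact_y unfolding ct_par_def by blast
    thus "even ((fcard S1 + fcard I1) * (fcard S2 + fcard I2) + 0)" by simp
  qed
  thus ?thesis by simp
qed

lemma coact_x_anticomm: "coact_x i * coact_x j = - (coact_x j * coact_x i)"
proof -
  have "coact_x i * coact_x j = (-1) ^ 1 * (coact_x j * coact_x i)"
  proof (rule ctens_commute_aux)
    fix S1 R1 I1 S2 R2 I2
    assume "ext_coeff (ct_coeff (coact_x i) S1 R1) I1 \<noteq> 0" "ext_coeff (ct_coeff (coact_x j) S2 R2) I2 \<noteq> 0"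
    hence "even (fcard S1 + fcard I1 + 1)" "even (fcard S2 + fcard I2 + 1)"
      using ct_par_coact_x unfolding ct_par_def by blast+
    thus "even ((fcard S1 + fcard I1) * (fcard S2 + fcard I2) + 1)" by simp
  qed
  thus ?thesis by simp
qed


lemma two_neq_0:
  assumes "odd CARD('p::prime_card)"
  shows "(2 :: 'p mod_ring) \<noteq> 0"
proof
  assume "(2 :: 'p mod_ring) = 0"
  hence "of_nat 2 = (0 :: 'p mod_ring)" by simp
  hence "CARD('p) dvd 2" by (rule of_nat_0_mod_ring_dvd)
  moreover have "CARD('p) > 1" using prime_card[where ?'a = 'p] by (rule prime_gt_1_nat)
  ultimately have "CARD('p) = 2" using dvd_imp_le[of "CARD('p)" 2] by simp
  thus False using assms by simp
qed

lemma coact_x_sq: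
  assumes "odd CARD('p::prime_card)"
  shows "coact_x i * (coact_x i :: 'p pol ctens) = 0"
proof (rule ctens_eqI, rule gca_eqI)
  fix S R I a
  let ?Z = "coact_x i * (coact_x i :: 'p pol ctens)"
  have "?Z + ?Z = 0" using coact_x_anticomm[of i i] by (metis add.right_inverse)
  hence "gcoeff (ct_coeff (?Z + ?Z) S R) I a = 0" by simp
  hence "2 * gcoeff (ct_coeff ?Z S R) I a = 0" by simp
  thus "gcoeff (ct_coeff ?Z S R) I a = gcoeff (ct_coeff 0 S R) I a"
    using two_neq_0[OF assms] by simp
qed

definition ct_scalar :: "'p::prime_card mod_ring \<Rightarrow> 'p pol ctens" where
  "ct_scalar c = gmonom c {||} 0 \<otimes>\<otimes> 1"

lemma ct_coeff_scalar: "ct_coeff (ct_scalar c) S R = (if S = {||} \<and> R = 0 then gmonom c {||} 0 else 0)"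
  by (simp add: ct_scalar_def tens_def gcoeff_1)

lemma ct_coeff_scalar_mult: "ct_coeff (ct_scalar c * F) S R = smul c (ct_coeff F S R)"
proof -
  have "ct_coeff (ct_scalar c * F) S R = (\<Sum>(S1, S2)\<in>splits S. \<Sum>(R1, R2)\<in>poly_splits R.
      shuffle_sign S1 S2 * (if S1 = {||} \<and> R1 = 0 then gmonom c {||} 0 else 0) *
      twist (fcard S1) (ct_coeff F S2 R2))"
    by (simp add: times_ctens.rep_eq ct_coeff_scalar)
  also have "\<dots> = (\<Sum>(R1, R2)\<in>poly_splits R. (if R1 = 0 then gmonom c {||} 0 else 0) * ct_coeff F S R2)"
    by (subst sum_splits_1) (auto simp: fcard_fempty)
  also have "\<dots> = smul c (ct_coeff F S R)"
    by (subst sum_poly_splits_1) (auto simp: smul_def)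
  finally show ?thesis .
qed

lemma ct_scalar_0 [simp]: "ct_scalar 0 = 0"
  by (rule ctens_eqI) (simp add: ct_coeff_scalar)

lemma ct_scalar_1 [simp]: "ct_scalar 1 = 1"
  by (rule ctens_eqI) (simp add: ct_coeff_scalar ct_coeff_1 one_eq_gmonom)

lemma ct_scalar_add: "ct_scalar (c + d) = ct_scalar c + ct_scalar d"
  by (rule ctens_eqI) (simp add: ct_coeff_scalar gmonom_add)

lemma ct_scalar_mult: "ct_scalar (c * d) = ct_scalar c * ct_scalar d"
  by (rule ctens_eqI, subst ct_coeff_scalar_mult) (simp add: ct_coeff_scalar smul_gmonom)

lemma ct_scalar_minus: "ct_scalar (- c) = - ct_scalar c"
  using ct_scalar_add[of c "- c"] by (simp add: eq_neg_iff_add_eq_0 add.commute)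

lemma ct_scalar_sign: "ct_scalar ((-1) ^ k) = (-1) ^ k"
  by (cases "even k") (simp_all add: ct_scalar_minus)

lemma ct_scalar_central: "ct_scalar c * F = F * ct_scalar c"
proof -
  have "ct_scalar c * F = (-1) ^ 0 * (F * ct_scalar c)"
  proof (rule ctens_commute_aux)
    fix S1 R1 I1 S2 R2 I2
    assume "ext_coeff (ct_coeff (ct_scalar c) S1 R1) I1 \<noteq> 0"
    hence "S1 = {||} \<and> I1 = {||}"
      by (cases "S1 = {||} \<and> R1 = 0") (simp_all add: ct_coeff_scalar ext_coeff_gmonomD)
    thus "even ((fcard S1 + fcard I1) * (fcard S2 + fcard I2) + 0)" by (simp add: fcard_fempty)
  qed
  thus ?thesis by simp
qed

definition coact_xs :: "nat \<Rightarrow> nat fset \<Rightarrow> 'p::prime_card pol ctens" where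
  "coact_xs N I = prod_list (map (\<lambda>i. if i |\<in>| I then coact_x i else 1) [0..<N])"

definition coact_ys :: "nat \<Rightarrow> (nat \<Rightarrow>\<^sub>0 nat) \<Rightarrow> 'p::prime_card pol ctens" where
  "coact_ys N a = prod_list (map (\<lambda>i. coact_y i ^ Poly_Mapping.lookup a i) [0..<N])"

lemma prod_list_filter_upt:
  assumes "finite A" "A \<subseteq> {..<N}" "\<And>i. i \<notin> A \<Longrightarrow> f i = (1 :: 'a::monoid_mult)"
  shows "prod_list (map f (sorted_list_of_set A)) = prod_list (map f [0..<N])"
proof -
  have "sorted_list_of_set A = filter (\<lambda>i. i \<in> A) [0..<N]"
    using assms(1,2) by (intro sorted_distinct_set_unique) (auto simp: sorted_wrt_filter)
  moreover have "prod_list (map f (filter (\<lambda>i. i \<in> A) xs)) = prod_list (map f xs)" for xs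
    by (induction xs) (use assms(3) in auto)
  ultimately show ?thesis by simp
qed

lemma coact_xs_eq:
  assumes "fset I \<subseteq> {..<N}"
  shows "prod_list (map coact_x (sorted_list_of_fset I)) = coact_xs N I"
proof -
  have "prod_list (map coact_x (sorted_list_of_set (fset I))) =
      prod_list (map (\<lambda>i. if i |\<in>| I then coact_x i else 1) (sorted_list_of_set (fset I)))"
    by (intro arg_cong[of _ _ prod_list] map_cong) auto
  also have "\<dots> = coact_xs N I"
    unfolding coact_xs_def using assms by (intro prod_list_filter_upt) auto
  finally show ?thesis by (simp add: sorted_list_of_fset.rep_eq)
qed

lemma coact_ys_eq:
  assumes "Poly_Mapping.keys a \<subseteq> {..<N}"
  shows "prod_list (map (\<lambda>i. coact_y i ^ Poly_Mapping.lookup a i) (sorted_list_of_set (Poly_Mapping.keys a))) =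
    coact_ys N a"
  unfolding coact_ys_def using assms by (intro prod_list_filter_upt) (auto simp: in_keys_iff)

lemma coact_y_power_central: "coact_y i ^ k * F = F * coact_y i ^ k"
  by (rule power_commuting_commutes) (rule coact_y_central)

lemma coact_ys_central: "coact_ys N a * F = F * (coact_ys N a :: 'p::prime_card pol ctens)"
proof (induction N)
  case (Suc N)
  let ?y = "coact_y N ^ Poly_Mapping.lookup a N :: 'p pol ctens"
  have Suc': "coact_ys (Suc N) a = coact_ys N a * ?y"
    by (simp add: coact_ys_def)
  have "coact_ys (Suc N) a * F = coact_ys N a * (?y * F)"
    by (simp only: Suc' mult.assoc)
  also have "?y * F = F * ?y" by (rule coact_y_power_central)
  also have "coact_ys N a * (F * ?y) = coact_ys N a * F * ?y" by (simp only: mult.assoc)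
  also have "\<dots> = F * coact_ys (Suc N) a" by (simp only: Suc Suc' mult.assoc)
  finally show ?case .
qed (simp add: coact_ys_def)

lemma coact_ys_add: "(coact_ys N (a + b) :: 'p::prime_card pol ctens) = coact_ys N a * coact_ys N b"
proof (induction N)
  case (Suc N)
  let ?y = "\<lambda>a. coact_y N ^ Poly_Mapping.lookup a N :: 'p pol ctens"
  have Suc': "coact_ys (Suc N) a = coact_ys N a * ?y a" for a
    by (simp add: coact_ys_def)
  have "coact_ys (Suc N) (a + b) = coact_ys N a * (coact_ys N b * ?y a) * ?y b"
    by (simp add: Suc' Suc lookup_add power_add mult.assoc)
  also have "coact_ys N b * ?y a = ?y a * coact_ys N b"
    by (rule coact_ys_central)
  finally show ?case by (simp add: Suc' mult.assoc)
qed (simp add: coact_ys_def)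

lemma coact_x_past:
  "M \<le> N \<Longrightarrow> coact_x N * coact_xs M J =
    (-1) ^ card (fset J \<inter> {..<M}) * (coact_xs M J * coact_x N :: 'p::prime_card pol ctens)"
proof (induction M)
  case (Suc M)
  have XN: "coact_xs (Suc M) J = coact_xs M J * (if M |\<in>| J then coact_x M else 1)"
    by (simp add: coact_xs_def)
  have IH: "coact_x N * coact_xs M J = (-1) ^ card (fset J \<inter> {..<M}) * (coact_xs M J * coact_x N :: 'p pol ctens)"
    using Suc by simp
  show ?case
  proof (cases "M |\<in>| J")
    case True
    hence "fset J \<inter> {..<Suc M} = insert M (fset J \<inter> {..<M})" by auto
    hence card: "card (fset J \<inter> {..<Suc M}) = Suc (card (fset J \<inter> {..<M}))" by simp
    have "coact_x N * coact_xs (Suc M) J = coact_x N * coact_xs M J * (coact_x M :: 'p pol ctens)"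
      using True by (simp add: XN mult.assoc)
    also have "\<dots> = (-1) ^ card (fset J \<inter> {..<M}) * (coact_xs M J * (coact_x N * coact_x M))"
      unfolding IH by (simp add: mult.assoc)
    also have "coact_x N * coact_x M = - (coact_x M * coact_x N :: 'p pol ctens)"
      by (rule coact_x_anticomm)
    finally show ?thesis using True by (simp add: XN card mult.assoc)
  next
    case False
    hence "fset J \<inter> {..<Suc M} = fset J \<inter> {..<M}" by (auto simp: less_Suc_eq)
    thus ?thesis using False IH by (simp add: XN)
  qed
qed (simp add: coact_xs_def)

lemma coact_xs_mult:
  assumes p: "odd CARD('p::prime_card)"
  shows "(coact_xs N I :: 'p pol ctens) * coact_xs N J =
    (if fset I \<inter> fset J \<inter> {..<N} = {}
     then (-1) ^ card {(i, j). i |\<in>| I \<and> j |\<in>| J \<and> j < i \<and> i < N} * coact_xs N (I |\<union>| J) else 0)"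
proof (induction N)
  case (Suc N)
  let ?P = "\<lambda>N. {(i, j). i |\<in>| I \<and> j |\<in>| J \<and> j < i \<and> i < N}"
  let ?x = "\<lambda>I. if N |\<in>| I then coact_x N else (1 :: 'p pol ctens)"
  let ?e = "if N |\<in>| I then card (fset J \<inter> {..<N}) else 0"
  have XN: "(coact_xs (Suc N) I :: 'p pol ctens) = coact_xs N I * ?x I" for I
    by (simp add: coact_xs_def)
  have past: "?x I * coact_xs N J = (-1) ^ ?e * (coact_xs N J * ?x I)"
    using coact_x_past[of N N J, where ?'p = 'p] by simp
  have sgn: "f * ((-1) ^ k * g) = (-1) ^ k * (f * g)" for f g :: "'p pol ctens" and k
    by (cases "even k") simp_all
  have 1: "coact_xs (Suc N) I * coact_xs (Suc N) J =
      (-1) ^ ?e * (coact_xs N I * coact_xs N J * (?x I * ?x J))"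
  proof -
    have "coact_xs (Suc N) I * coact_xs (Suc N) J = coact_xs N I * (?x I * coact_xs N J) * ?x J"
      unfolding XN by (simp only: mult.assoc)
    also have "\<dots> = (-1) ^ ?e * (coact_xs N I * coact_xs N J * (?x I * ?x J))"
      unfolding past sgn mult.assoc ..
    finally show ?thesis .
  qed
  show ?case
  proof (cases "N |\<in>| I \<and> N |\<in>| J")
    case True
    hence "fset I \<inter> fset J \<inter> {..<Suc N} \<noteq> {}" by auto
    thus ?thesis using True unfolding 1 by (simp add: coact_x_sq[OF p])
  next
    case False
    have 2: "?x I * ?x J = ?x (I |\<union>| J)" using False by auto
    have 3: "fset I \<inter> fset J \<inter> {..<Suc N} = fset I \<inter> fset J \<inter> {..<N}"
      using False by (auto simp: less_Suc_eq)
    have "?P (Suc N) = ?P N \<union> (if N |\<in>| I then {N} \<times> (fset J \<inter> {..<N}) else {})"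
      by (auto simp: less_Suc_eq)
    moreover have "finite (?P N)"
      by (rule finite_subset[of _ "fset I \<times> fset J"]) auto
    ultimately have 4: "card (?P (Suc N)) = ?e + card (?P N)"
      by (simp, subst card_Un_disjoint) (auto simp: card_cartesian_product)
    show ?thesis
      unfolding 1 unfolding 2 3 4 Suc XN power_add
      by (cases "fset I \<inter> fset J \<inter> {..<N} = {}") (simp_all only: if_True if_False mult.assoc mult_zero_left mult_zero_right simp_thms)
  qed
qed (simp add: coact_xs_def)

definition coact_term :: "nat \<Rightarrow> 'p::prime_card mod_ring \<Rightarrow> nat fset \<Rightarrow> (nat \<Rightarrow>\<^sub>0 nat) \<Rightarrow> 'p pol ctens" where
  "coact_term N c I a = ct_scalar c * coact_xs N I * coact_ys N a"

lemma coaction_eq: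
  assumes "finite A" "gsupp u \<subseteq> A" "\<And>I a. (I, a) \<in> A \<Longrightarrow> fset I \<subseteq> {..<N} \<and> Poly_Mapping.keys a \<subseteq> {..<N}"
  shows "coaction u = (\<Sum>(I, a)\<in>A. coact_term N (gcoeff u I a) I a)"
proof -
  have "coaction u = (\<Sum>(I, a)\<in>gsupp u. coact_term N (gcoeff u I a) I a)"
    unfolding coaction_def coact_term_def ct_scalar_def
  proof (intro sum_pair_cong)
    fix I a assume "(I, a) \<in> gsupp u"
    hence *: "fset I \<subseteq> {..<N}" "Poly_Mapping.keys a \<subseteq> {..<N}" using assms(2,3) by blast+
    show "gmonom (gcoeff u I a) {||} 0 \<otimes>\<otimes> 1 * prod_list (map coact_x (sorted_list_of_fset I)) *
      prod_list (map (\<lambda>i. coact_y i ^ Poly_Mapping.lookup a i) (sorted_list_of_set (Poly_Mapping.keys a))) =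
      gmonom (gcoeff u I a) {||} 0 \<otimes>\<otimes> 1 * coact_xs N I * coact_ys N a"
      by (simp only: coact_xs_eq[OF *(1)] coact_ys_eq[OF *(2)])
  qed
  also have "\<dots> = (\<Sum>(I, a)\<in>A. coact_term N (gcoeff u I a) I a)"
    using assms(1,2) by (intro sum.mono_neutral_left) (auto simp: gsupp_def coact_term_def)
  finally show ?thesis .
qed

lemma gsupp_bound:
  assumes "finite A"
  obtains N :: nat where "\<And>I a. (I, a :: nat \<Rightarrow>\<^sub>0 nat) \<in> A \<Longrightarrow> fset I \<subseteq> {..<N} \<and> Poly_Mapping.keys a \<subseteq> {..<N}"
proof -
  have "finite (\<Union>(I, a)\<in>A. fset I \<union> Poly_Mapping.keys a)"
    using assms by auto
  then obtain N where "\<forall>i\<in>(\<Union>(I, a)\<in>A. fset I \<union> Poly_Mapping.keys a). i < N"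
    using finite_nat_set_iff_bounded by auto
  thus ?thesis by (intro that[of N]) fastforce
qed

lemma coaction_add: "coaction (u + v) = coaction u + coaction v"
proof -
  let ?A = "gsupp u \<union> gsupp v"
  obtain N where N: "\<And>I a. (I, a) \<in> ?A \<Longrightarrow> fset I \<subseteq> {..<N} \<and> Poly_Mapping.keys a \<subseteq> {..<N}"
    using gsupp_bound[of ?A] by blast
  have sub: "gsupp (u + v) \<subseteq> ?A" by (auto simp: gsupp_def)
  show ?thesis
    using coaction_eq[OF _ sub N] coaction_eq[of ?A u N] coaction_eq[of ?A v N] N
    by (simp add: coact_term_def ct_scalar_add algebra_simps sum.distrib case_prod_unfold)
qed

lemma coaction_0 [simp]: "coaction 0 = 0"
  by (simp add: coaction_def gsupp_def)

lemma coaction_sum: "coaction (sum f A) = (\<Sum>a\<in>A. coaction (f a))"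
  by (induction A rule: infinite_finite_induct) (auto simp: coaction_add)

lemma coaction_gmonom:
  assumes "fset I \<subseteq> {..<N}" "Poly_Mapping.keys a \<subseteq> {..<N}"
  shows "coaction (gmonom c I a) = coact_term N c I a"
proof -
  have "gsupp (gmonom c I a) \<subseteq> {(I, a)}"
    by (clarsimp simp: gsupp_def gcoeff_gmonom split: if_splits)
  thus ?thesis using coaction_eq[of "{(I, a)}" "gmonom c I a" N] assms by (simp add: gcoeff_gmonom)
qed

lemma coaction_mult:
  assumes p: "odd CARD('p::prime_card)"
  shows "coaction (u * v :: 'p gca) = coaction u * coaction v"
proof -
  have mono: "coaction (gmonom c I a * gmonom d J b :: 'p gca) = coaction (gmonom c I a) * coaction (gmonom d J b)"
    for c d I J a b
  proof -
    obtain N where N: "fset I \<subseteq> {..<N}" "fset J \<subseteq> {..<N}" "Poly_Mapping.keys a \<subseteq> {..<N}" "Poly_Mapping.keys b \<subseteq> {..<N}"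
    proof (rule gsupp_bound[of "{(I, a), (J, b)}"])
      fix N assume *: "\<And>K b'. (K, b') \<in> {(I, a), (J, b)} \<Longrightarrow> fset K \<subseteq> {..<N} \<and> Poly_Mapping.keys b' \<subseteq> {..<N}"
      show thesis using *[of I a] *[of J b] by (intro that[of N]) simp_all
    qed simp
    have keys: "Poly_Mapping.keys (a + b) \<subseteq> {..<N}" using N Poly_Mapping.keys_add[of a b] by blast
    have inv: "{(i, j). i |\<in>| I \<and> j |\<in>| J \<and> j < i \<and> i < N} = {(i, j). i |\<in>| I \<and> j |\<in>| J \<and> j < i}"
      using N(1) by auto
    have disj: "fset I \<inter> fset J \<inter> {..<N} = {} \<longleftrightarrow> I |\<inter>| J = {||}"
      using N(1) by (auto simp: fset_eq_iff)
    have "coact_term N c I a * coact_term N d J b =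
        ct_scalar c * (coact_xs N I * (coact_ys N a * ct_scalar d)) * coact_xs N J * coact_ys N b"
      by (simp add: coact_term_def mult.assoc)
    also have "coact_ys N a * ct_scalar d = ct_scalar d * coact_ys N a"
      by (rule coact_ys_central)
    also have "ct_scalar c * (coact_xs N I * (ct_scalar d * coact_ys N a)) * coact_xs N J * coact_ys N b =
        ct_scalar c * (coact_xs N I * ct_scalar d) * (coact_ys N a * coact_xs N J) * coact_ys N b"
      by (simp add: mult.assoc)
    also have "coact_xs N I * ct_scalar d = ct_scalar d * (coact_xs N I :: 'p pol ctens)"
      by (rule ct_scalar_central[symmetric])
    also have "coact_ys N a * coact_xs N J = coact_xs N J * (coact_ys N a :: 'p pol ctens)"
      by (rule coact_ys_central)
    also have "ct_scalar c * (ct_scalar d * coact_xs N I) * (coact_xs N J * coact_ys N a) * coact_ys N b =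
        ct_scalar (c * d) * (coact_xs N I * coact_xs N J) * coact_ys N (a + b)"
      by (simp add: ct_scalar_mult coact_ys_add mult.assoc)
    also have "\<dots> = coaction (gmonom c I a * gmonom d J b)"
    proof (cases "I |\<inter>| J = {||}")
      case False
      thus ?thesis unfolding coact_xs_mult[OF p] inv disj by (simp add: gmonom_mult)
    next
      case True
      have "coaction (gmonom c I a * gmonom d J b) = coact_term N (shuffle_sign I J * c * d) (I |\<union>| J) (a + b)"
        using True N keys by (simp add: gmonom_mult, intro coaction_gmonom) auto
      also have "\<dots> = ct_scalar (c * d * (-1) ^ card {(i, j). i |\<in>| I \<and> j |\<in>| J \<and> j < i}) *
          coact_xs N (I |\<union>| J) * coact_ys N (a + b)"
        by (simp add: coact_term_def shuffle_sign_def mult_ac)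
      finally show ?thesis
        using True unfolding coact_xs_mult[OF p] inv disj ct_scalar_mult ct_scalar_sign by (simp add: mult.assoc)
    qed
    finally have "coact_term N c I a * coact_term N d J b = coaction (gmonom c I a * gmonom d J b)" .
    thus ?thesis using N by (simp add: coaction_gmonom)
  qed
  define U V where "U = (\<Sum>z\<in>gsupp u. gmonom (gcoeff u (fst z) (snd z)) (fst z) (snd z))"
    and "V = (\<Sum>z\<in>gsupp v. gmonom (gcoeff v (fst z) (snd z)) (fst z) (snd z))"
  have "u = U" "v = V"
    using gca_decomp[of "gsupp u" u] gca_decomp[of "gsupp v" v]
    by (simp_all add: case_prod_unfold U_def V_def)
  moreover have "coaction (U * V) = coaction U * coaction V"
    by (simp only: U_def V_def sum_product coaction_sum mono)
  ultimately show ?thesis by simp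
qed


lemma coaction_1: "coaction 1 = 1"
  using coaction_gmonom[of "{||}" 0 0 1] by (simp add: one_eq_gmonom coact_term_def coact_xs_def coact_ys_def)

lemma coaction_hx: "coaction (hx i :: 'p::prime_card gca) = coact_x i"
proof -
  have "gsupp (hx i :: 'p gca) = {({|i|}, 0)}"
    by (auto simp: gsupp_def hx_def odd_gen_def gcoeff_gmonom split: if_splits)
  thus ?thesis
    by (simp add: coaction_def hx_def odd_gen_def gcoeff_gmonom sorted_list_of_fset.rep_eq
        flip: ct_scalar_def)
qed

lemma coaction_hy: "coaction (hy i :: 'p::prime_card gca) = coact_y i"
proof -
  have "gsupp (hy i :: 'p gca) = {({||}, Poly_Mapping.single i 1)}"
    by (auto simp: gsupp_def hy_def even_gen_def gcoeff_gmonom split: if_splits)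
  thus ?thesis
    by (simp add: coaction_def hy_def even_gen_def gcoeff_gmonom sorted_list_of_fset.rep_eq
        flip: ct_scalar_def)
qed

subsection \<open>The Steenrod algebra and its action\<close>

text \<open>
  For \<open>S\<close> strictly increasing, the monomial \<open>\<tau>\<^sub>S\<xi>\<^sup>R\<close> is the basis element
  \<open>gmonom 1 (fset_of_list S) (Poly_Mapping.nth R)\<close>; note the shift by one between the generators
  \<open>\<xi>\<^sub>1, \<xi>\<^sub>2, \<dots>\<close> and the positions in \<open>R\<close>.
\<close>

lemma tau_xi_monomial:
  assumes "sorted_wrt (<) S"
  shows "prod_list (map tau S) * prod_list (map (\<lambda>i. xi (Suc i) ^ (R ! i)) [0..<length R]) =
    (gmonom 1 (fset_of_list S) (Poly_Mapping.nth R) :: 'p::prime_card gca)"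
proof -
  have 1: "prod_list (map tau S) = (gmonom 1 (fset_of_list S) 0 :: 'p gca)"
    using assms
  proof (induction S)
    case (Cons s S)
    have "{(i, j). i |\<in>| {|s|} \<and> j |\<in>| fset_of_list S \<and> j < i} = {}"
      using Cons.prems by (force simp: fset_of_list_elem)
    hence "(shuffle_sign {|s|} (fset_of_list S) :: 'p mod_ring) = 1"
      unfolding shuffle_sign_def by (simp only: card.empty power_0)
    moreover have "s |\<notin>| fset_of_list S"
      using Cons.prems by (auto simp: fset_of_list_elem)
    ultimately show ?case
      using Cons by (simp add: tau_def odd_gen_def gmonom_mult)
  qed (simp add: one_eq_gmonom)
  have pow: "xi (Suc i) ^ k = (gmonom 1 {||} (Poly_Mapping.single i k) :: 'p gca)" for i k
    using hy_power[of i k, where ?'a = 'p] by (simp add: xi_def hy_def)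
  have 2: "prod_list (map (\<lambda>i. xi (Suc i) ^ (R ! i)) [0..<length R]) = (gmonom 1 {||} (Poly_Mapping.nth R) :: 'p gca)"
  proof (induction R rule: rev_induct)
    case (snoc r R)
    have "Poly_Mapping.nth (R @ [r]) = Poly_Mapping.nth R + Poly_Mapping.single (length R) r"
      by (rule poly_mapping_eqI)
         (auto simp: lookup_add lookup_single nth_default_def nth_append when_def)
    moreover have "map (\<lambda>i. xi (Suc i) ^ ((R @ [r]) ! i) :: 'p gca) [0..<length R] =
        map (\<lambda>i. xi (Suc i) ^ (R ! i)) [0..<length R]"
      by (intro map_cong) (auto simp: nth_append)
    hence "prod_list (map (\<lambda>i. xi (Suc i) ^ ((R @ [r]) ! i) :: 'p gca) [0..<length R]) =
        gmonom 1 {||} (Poly_Mapping.nth R)"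
      using snoc by metis
    ultimately show ?case
      by (simp add: gmonom_mult pow[of "length R" r])
  qed (simp add: one_eq_gmonom)
  show ?thesis by (simp add: 1 2 gmonom_mult)
qed

definition steenrod_algebra :: "('p::prime_card gca \<Rightarrow> 'p mod_ring) set" where
  "steenrod_algebra = {\<theta>. (\<forall>a b. \<theta> (a + b) = \<theta> a + \<theta> b) \<and> (\<forall>c a. \<theta> (smul c a) = c * \<theta> a) \<and>
     finite {(S, R). \<theta> (gmonom 1 S R) \<noteq> 0}}"

definition St :: "nat list \<Rightarrow> nat list \<Rightarrow> 'p::prime_card gca \<Rightarrow> 'p mod_ring" where
  "St S R = (\<lambda>a. gcoeff a (fset_of_list S) (Poly_Mapping.nth R))"

lemma St_basis: "{(S', R'). St S R (gmonom 1 S' R') \<noteq> 0} = {(fset_of_list S, Poly_Mapping.nth R)}"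
  by (simp add: St_def gcoeff_gmonom)

lemma St_in_steenrod_algebra: "St S R \<in> steenrod_algebra"
  unfolding steenrod_algebra_def by (simp add: St_basis) (simp add: St_def gcoeff_smul)

text \<open>
  The action of \<open>\<theta> = \<Sum> \<theta>(\<tau>\<^sub>S\<xi>\<^sup>R) St\<^bsup>S,R\<^esup>\<close>, obtained by solving
  \<open>\<lambda>(u) = \<Sum> (-1)\<^bsup>t(dim u - t)\<^esup> St\<^bsup>S,R\<^esup> u \<otimes> \<tau>\<^sub>S\<xi>\<^sup>R\<close>, \<open>t\<close> the length
  of \<open>S\<close>, on each homogeneous component of \<open>u\<close>.
\<close>

definition steenrod_act :: "('p::prime_card gca \<Rightarrow> 'p mod_ring) \<Rightarrow> 'p gca \<Rightarrow> 'p gca" (infixr \<open>\<bullet>\<bullet>\<close> 73) where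
  "\<theta> \<bullet>\<bullet> u = (\<Sum>d\<in>(\<lambda>(I, a). hdim I a) ` gsupp u. \<Sum>(S, R)\<in>{(S, R). \<theta> (gmonom 1 S R) \<noteq> 0}.
     smul (\<theta> (gmonom 1 S R) * (- 1) powi (int (fcard S) * (int d - int (fcard S))))
       (ct_coeff (coaction (hcomp d u)) S R))"

lemma coaction_eq_steenrod_act:
  assumes "hcomp d u = (u :: 'p::prime_card gca)" "distinct S"
  shows "ct_coeff (coaction u) (fset_of_list S) (Poly_Mapping.nth R) =
    smul ((- 1) powi (int (length S) * (int d - int (length S)))) (St S R \<bullet>\<bullet> u)"
proof (cases "gsupp u = {}")
  case True
  hence "u = 0" by (intro gca_eqI) (auto simp: gsupp_def)
  thus ?thesis using True by (simp add: steenrod_act_def)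
next
  case False
  have card: "fcard (fset_of_list S) = length S"
    using assms(2) by (simp add: fcard.rep_eq fset_of_list.rep_eq distinct_card)
  have "hdim I a = d" if "(I, a) \<in> gsupp u" for I a
  proof (rule ccontr)
    assume "hdim I a \<noteq> d"
    hence "gcoeff (hcomp d u) I a = 0"
      unfolding hcomp_def gcoeff_sum by (intro sum.neutral) (auto simp: gcoeff_gmonom)
    thus False using that assms(1) by (simp add: gsupp_def)
  qed
  hence "(\<lambda>(I, a). hdim I a) ` gsupp u = {d}" using False by force
  moreover have "St S R (gmonom 1 (fset_of_list S) (Poly_Mapping.nth R)) = (1 :: 'p mod_ring)"
    by (simp add: St_def gcoeff_gmonom)
  moreover have "(- 1 :: 'p mod_ring) powi k * (- 1) powi k = 1" for k
    by (simp add: power_int_minus_one_mult_self)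
  ultimately show ?thesis
    by (simp add: steenrod_act_def St_basis card assms(1) smul_smul)
qed

section \<open>Mui invariants\<close>

definition hy_pol :: "nat \<Rightarrow> 'p::prime_card pol" where
  "hy_pol i = Poly_Mapping.single (Poly_Mapping.single i 1) 1"

definition ext_const :: "'a::zero \<Rightarrow> 'a ext" where
  "ext_const f = ext_monom f {||}"

lemma hy_eq: "hy i = ext_const (hy_pol i)"
  by (simp add: hy_def even_gen_def gmonom_def hy_pol_def ext_const_def)

definition mui_perm :: "nat \<Rightarrow> nat set \<Rightarrow> nat \<Rightarrow> nat" where
  "mui_perm n I j = (if j \<in> {1..n}
     then (sorted_list_of_set I @ sorted_list_of_set ({1..n} - I)) ! (j - 1) else j)"

text \<open>\<open>mui n k as\<close> is \<open>[k; a\<^bsub>k+1\<^esub>, \<dots>, a\<^sub>n]\<close> for \<open>as\<close> the list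
  \<open>a\<^bsub>k+1\<^esub>, \<dots>, a\<^sub>n\<close> of length \<open>n - k\<close>.\<close>

definition mui :: "nat \<Rightarrow> nat \<Rightarrow> nat list \<Rightarrow> 'p::prime_card gca" where
  "mui n k as = (\<Sum>I | I \<subseteq> {1..n} \<and> card I = k.
     of_int (sign (mui_perm n I)) * prod_list (map hx (sorted_list_of_set I)) *
     ext_const (det (mat (n - k) (n - k)
       (\<lambda>(u, v). hy_pol (sorted_list_of_set ({1..n} - I) ! u) ^ (CARD('p) ^ (as ! v))))))"

section \<open>Ordered decompositions\<close>

definition ordered_decomp :: "nat \<Rightarrow> nat \<Rightarrow> nat \<Rightarrow> (nat \<Rightarrow> nat set) \<Rightarrow> bool" where
  "ordered_decomp n k m J \<longleftrightarrow> (\<Union>s\<le>m. J s) = {k+1..n} \<and> disjoint_family_on J {..m}"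

definition R_of :: "nat \<Rightarrow> (nat \<Rightarrow> nat) \<Rightarrow> nat \<Rightarrow> (nat \<Rightarrow> nat set) \<Rightarrow> nat list" where
  "R_of p e m J = map (\<lambda>s. \<Sum>j\<in>J s. p ^ e j) [1..<m+1]"

definition Phi :: "nat \<Rightarrow> (nat \<Rightarrow> nat set) \<Rightarrow> nat \<Rightarrow> nat" where
  "Phi m J i = (THE s. s \<le> m \<and> i \<in> J s)"

end

theory Submission
  imports Defs
begin

text \<open>
  Mui's invariant can be expanded along the variables \<open>x\<^sub>n, y\<^sub>n\<close> with the largest index: either
  \<open>x\<^sub>n\<close> is the last odd factor, or some power \<open>y\<^sub>n^p^a\<close> is split off the determinant, and what
  remains is an invariant in \<open>n - 1\<close> variables. The coaction \<open>\<lambda>\<close> is multiplicative, and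
  \<open>\<lambda>(y\<^sub>n^p^a) = \<Sum>\<^sub>j y\<^sub>n^p^(a+j) \<otimes> \<xi>\<^sub>j^p^a\<close> by the Frobenius. Hence the coefficient of
  \<open>\<tau>\<^sub>S\<xi>\<^sup>R\<close> in \<open>\<lambda>[k; e]\<close> satisfies a recursion in \<open>n\<close>, in which \<open>\<lambda>(x\<^sub>n)\<close> contributes
  \<open>x\<^sub>n\<close> and the \<open>y\<^sub>n^p^s\<close> with \<open>s\<close> in \<open>S\<close>, and \<open>\<lambda>(y\<^sub>n^p^a)\<close> contributes
  \<open>y\<^sub>n^p^(a + \<Phi>(a))\<close>; this is exactly the expansion of \<open>[k - t; S, e + \<Phi>]\<close>. Only one \<open>\<Phi>\<close>
  occurs for a given \<open>R\<close>: as the \<open>e\<^sub>i\<close> are distinct, the base \<open>p\<close> digits of \<open>r\<^sub>s\<close> are 0 or 1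
  and determine \<open>{i. \<Phi>(i) = s}\<close>.
\<close>

section \<open>Alternating sums over the elements of a list\<close>

text \<open>
  The expansion of a determinant along its last row, \<open>f a bs\<close> standing for the entry in column \<open>a\<close>
  times the minor on the other columns \<open>bs\<close>. Each sign is determined by the number of columns to
  the right of \<open>a\<close>.
\<close>

primrec altsum :: "('a \<Rightarrow> 'a list \<Rightarrow> 'r::ring_1) \<Rightarrow> 'a list \<Rightarrow> 'r" where
  "altsum f [] = 0"
| "altsum f (a # as) = (- 1) ^ length as * f a as + altsum (\<lambda>b bs. f b (a # bs)) as"

text \<open>The hypothesis ranges over splittings of \<open>as\<close>, so that applications can use
  what is known about the remaining list: its length, sortedness or distinctness.\<close>

lemma altsum_cong:
  assumes "\<And>xs a ys. as = xs @ a # ys \<Longrightarrow> f a (xs @ ys) = g a (xs @ ys)"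
  shows "altsum f as = altsum g as"
  using assms
proof (induction as arbitrary: f g)
  case (Cons a as)
  have "f a as = g a as" using Cons.prems[of "[]" a as] by simp
  moreover have "altsum (\<lambda>b bs. f b (a # bs)) as = altsum (\<lambda>b bs. g b (a # bs)) as"
  proof (rule Cons.IH)
    fix xs b ys assume "as = xs @ b # ys"
    thus "f b (a # xs @ ys) = g b (a # xs @ ys)" using Cons.prems[of "a # xs" b ys] by simp
  qed
  ultimately show ?case by simp
qed simp

lemma altsum_zero: "altsum (\<lambda>_ _. 0) as = 0"
  by (induction as) auto

lemma altsum_map: "altsum f (map h as) = altsum (\<lambda>a bs. f (h a) (map h bs)) as"
  by (induction as arbitrary: f) auto

lemma minus_one_power_left_commute: "a * ((- 1) ^ k * b) = (- 1) ^ k * (a * b :: 'r::ring_1)"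
  by (cases "even k") auto

text \<open>Additivity suffices because the only coefficients are signs. Applied to
  \<open>coaction\<close>, to taking a coefficient, to \<open>ext_const\<close> and to left
  multiplication.\<close>

lemma altsum_hom:
  assumes "\<And>a b. h (a + b) = h a + h b" and "\<And>a. h (- a) = - h a"
  shows "h (altsum f as) = altsum (\<lambda>a bs. h (f a bs)) as"
proof -
  have "h 0 = 0" using assms(1)[of 0 0] by simp
  moreover have "h ((- 1) ^ k * a) = (- 1) ^ k * h a" for k a
    by (cases "even k") (auto simp: assms)
  ultimately show ?thesis
    by (induction as arbitrary: f) (auto simp: assms)
qed

text \<open>All of \<open>bs\<close> lies to the right of an entry picked from \<open>as\<close>,
  whence the extra sign. This separates the entries of \<open>S\<close> from those of
  \<open>es\<close> in the expansion for \<open>S @ es\<close>.\<close>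

lemma altsum_append:
  "altsum f (as @ bs) =
    (- 1) ^ length bs * altsum (\<lambda>a cs. f a (cs @ bs)) as + altsum (\<lambda>b cs. f b (as @ cs)) bs"
proof (induction as arbitrary: f)
  case (Cons a as)
  show ?case
    by (simp add: Cons[of "\<lambda>b cs. f b (a # cs)"] power_add distrib_left mult.assoc[symmetric] add.assoc)
       (simp add: power_add[symmetric] add.commute)
qed simp

lemma altsum_conv_sum:
  "altsum f as = (\<Sum>j<length as. (- 1) ^ (length as - 1 - j) * f (as ! j) (take j as @ drop (Suc j) as))"
  by (induction as arbitrary: f) (simp_all add: sum.lessThan_Suc_shift del: sum.lessThan_Suc)

text \<open>In a strictly increasing list the entries to the right of \<open>a\<close> are the
  larger ones, which are the inversions counted by \<open>shuffle_sign\<close>. This matches the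
  signs of \<open>altsum\<close> with those of the product in \<open>ctens\<close>.\<close>

lemma altsum_conv_sorted:
  fixes f :: "nat \<Rightarrow> nat fset \<Rightarrow> 'r::ring_1"
  assumes "sorted_wrt (<) (as :: nat list)"
  shows "altsum (\<lambda>a bs. f a (fset_of_list bs)) as =
    (\<Sum>a\<in>set as. shuffle_sign (fset_of_list as |-| {|a|}) {|a|} * f a (fset_of_list as |-| {|a|}))"
  using assms
proof (induction as arbitrary: f)
  case (Cons a as)
  have a: "a \<notin> set as" "\<And>b. b \<in> set as \<Longrightarrow> a < b" using Cons.prems by auto
  have rm: "fset_of_list as |-| {|a|} = fset_of_list as"
    using a by (auto simp: fset_of_list_elem)
  have "{(i, j). i |\<in>| fset_of_list as \<and> j |\<in>| {|a|} \<and> j < i} = set as \<times> {a}"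
    using a by (auto simp: fset_of_list_elem)
  hence "card {(i, j). i |\<in>| fset_of_list as \<and> j |\<in>| {|a|} \<and> j < i} = length as"
    using Cons.prems by (simp add: card_cartesian_product distinct_card strict_sorted_iff)
  hence sgn: "shuffle_sign (fset_of_list as) {|a|} = ((- 1) ^ length as :: 'r)"
    by (simp only: shuffle_sign_def)
  have "altsum (\<lambda>b bs. f b (finsert a (fset_of_list bs))) as =
    (\<Sum>b\<in>set as. shuffle_sign (fset_of_list (a # as) |-| {|b|}) {|b|} * f b (fset_of_list (a # as) |-| {|b|}))"
    (is "_ = ?r")
  proof (subst Cons.IH[of "\<lambda>b B. f b (finsert a B)"])
    show "sorted_wrt (<) as" using Cons.prems by simp
    show "(\<Sum>b\<in>set as. shuffle_sign (fset_of_list as |-| {|b|}) {|b|} * f b (finsert a (fset_of_list as |-| {|b|}))) = ?r"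
    proof (intro sum.cong refl)
      fix b assume b: "b \<in> set as"
      have 1: "fset_of_list (a # as) |-| {|b|} = finsert a (fset_of_list as |-| {|b|})"
        using a(1) b by auto
      \<comment> \<open>As \<open>a < b\<close>, the new element \<open>a\<close> creates no
        inversion with \<open>b\<close>.\<close>
      have "{(i, j). i |\<in>| finsert a (fset_of_list as |-| {|b|}) \<and> j |\<in>| {|b|} \<and> j < i} =
          {(i, j). i |\<in>| (fset_of_list as |-| {|b|}) \<and> j |\<in>| {|b|} \<and> j < i}"
        using a(2)[OF b] by auto
      thus "shuffle_sign (fset_of_list as |-| {|b|}) {|b|} * f b (finsert a (fset_of_list as |-| {|b|})) =
          shuffle_sign (fset_of_list (a # as) |-| {|b|}) {|b|} * f b (fset_of_list (a # as) |-| {|b|})"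
        unfolding 1 shuffle_sign_def by simp
    qed
  qed
  thus ?case using a(1) by (simp add: sgn rm)
qed simp

section \<open>The Frobenius for commuting elements\<close>

text \<open>The completed tensor product is not commutative, so commutation is assumed only for the
  two elements concerned.\<close>

lemma commuting_binomial:
  fixes x y :: "'a::ring_1"
  assumes "x * y = y * x"
  shows "(x + y) ^ n = (\<Sum>k\<le>n. of_nat (n choose k) * x ^ k * y ^ (n - k))"
proof (induction n)
  case (Suc n)
  have yx: "y * x ^ k = x ^ k * y" for k
    using power_commuting_commutes[OF assms, of k] by simp
  have of_nat_left: "a * (of_nat c * b) = of_nat c * (a * b)" for a b :: 'a and c
    by (metis mult.assoc mult_of_nat_commute)
  have "(x + y) ^ Suc n = x * (x + y) ^ n + y * (x + y) ^ n" by (simp add: distrib_right)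
  also have "x * (x + y) ^ n = (\<Sum>k\<le>n. of_nat (n choose k) * x ^ Suc k * y ^ (n - k))"
    by (simp add: Suc sum_distrib_left mult.assoc of_nat_left)
  also have "y * (x + y) ^ n = (\<Sum>k\<le>n. of_nat (n choose k) * x ^ k * y ^ Suc (n - k))"
    by (simp add: Suc sum_distrib_left mult.assoc of_nat_left)
       (simp add: mult.assoc[symmetric] yx)
  also have "\<dots> = (\<Sum>k\<le>n. of_nat (n choose k) * x ^ k * y ^ (Suc n - k))"
    by (intro sum.cong refl) (simp add: Suc_diff_le)
  also have "\<dots> = (\<Sum>k\<le>Suc n. of_nat (n choose k) * x ^ k * y ^ (Suc n - k))"
    by (simp add: binomial_eq_0)
  also have "\<dots> = y ^ Suc n + (\<Sum>k\<le>n. of_nat (n choose Suc k) * x ^ Suc k * y ^ (n - k))"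
    by (subst sum.atMost_Suc_shift) simp
  also have "(\<Sum>k\<le>n. of_nat (n choose k) * x ^ Suc k * y ^ (n - k)) + \<dots> =
      (\<Sum>k\<le>Suc n. of_nat (Suc n choose k) * x ^ k * y ^ (Suc n - k))"
    by (subst sum.atMost_Suc_shift) (simp add: distrib_right sum.distrib algebra_simps)
  finally show ?case .
qed simp

lemma commuting_freshmans_dream:
  fixes x y :: "'a::ring_1"
  assumes "x * y = y * x" "prime p" "of_nat p = (0 :: 'a)"
  shows "(x + y) ^ p = x ^ p + y ^ p"
proof -
  have "p > 0" using assms(2) by (rule prime_gt_0_nat)
  have "of_nat (p choose k) = (0 :: 'a)" if "k \<noteq> 0" "k \<noteq> p" "k \<le> p" for k
  proof -
    have "p dvd p choose k" using that assms(2) by (intro dvd_choose_prime) auto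
    thus ?thesis using assms(3) by (elim dvdE) simp
  qed
  hence "(x + y) ^ p = (\<Sum>k\<in>{0, p}. of_nat (p choose k) * x ^ k * y ^ (p - k))"
    unfolding commuting_binomial[OF assms(1)]
    by (intro sum.mono_neutral_right) auto
  thus ?thesis using \<open>p > 0\<close> by (simp add: add.commute)
qed

text \<open>Powers of commuting elements commute again, so the \<open>p\<close>-th power can be
  taken \<open>e\<close> times in succession.\<close>

lemma commuting_freshmans_dream_sum:
  fixes f :: "'b \<Rightarrow> 'a::ring_1"
  assumes "finite A" "\<And>i j. f i * f j = f j * f i" "prime p" "of_nat p = (0 :: 'a)"
  shows "(\<Sum>i\<in>A. f i) ^ p ^ e = (\<Sum>i\<in>A. f i ^ p ^ e)"
proof (induction e)
  case (Suc e)
  define g where "g i = f i ^ p ^ e" for i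
  have comm: "g i * g j = g j * g i" for i j
    unfolding g_def by (intro power_commuting_commutes power_commuting_commutes[symmetric] assms(2))
  have "(\<Sum>i\<in>A. g i) ^ p = (\<Sum>i\<in>A. g i ^ p)"
    using assms(1)
  proof induction
    case empty
    thus ?case using assms(3) by (simp add: prime_gt_0_nat power_0_left)
  next
    case (insert a A)
    have "g a * (\<Sum>i\<in>A. g i) = (\<Sum>i\<in>A. g i) * g a"
      by (simp add: sum_distrib_left sum_distrib_right comm)
    thus ?case using insert by (simp add: commuting_freshmans_dream[OF _ assms(3,4)])
  qed
  thus ?case unfolding g_def Suc[symmetric] by (simp add: power_mult[symmetric] mult.commute)
qed simp

section \<open>Multiplication by the coaction on generators\<close>

text \<open>
  The infinite sum in \<open>coact_y\<close> can be replaced by a finite one modulo tensors in which every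
  \<open>\<xi>\<^sup>R\<close> involves a generator of index at least \<open>N\<close>; these tensors form a two-sided ideal.
\<close>

definition tens_eq_upto :: "nat \<Rightarrow> 'a::zero ctens \<Rightarrow> 'a ctens \<Rightarrow> bool" where
  "tens_eq_upto N F G \<longleftrightarrow>
     (\<forall>S R. Poly_Mapping.keys R \<subseteq> {..<N} \<longrightarrow> ct_coeff F S R = ct_coeff G S R)"

lemma keys_poly_splits:
  assumes "(A, B) \<in> poly_splits R"
  shows "Poly_Mapping.keys A \<subseteq> Poly_Mapping.keys R" "Poly_Mapping.keys B \<subseteq> Poly_Mapping.keys R"
  using assms by (auto simp: poly_splits_def in_keys_iff lookup_add)

text \<open>If \<open>R = R1 + R2\<close>, the supports of \<open>R1\<close> and \<open>R2\<close>
  lie in that of \<open>R\<close>, so a coefficient of the product at \<open>R\<close> sees only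
  coefficients on which the factors agree.\<close>

lemma tens_eq_upto_mult:
  fixes F F' G G' :: "'a::comm_ring_1 ctens"
  assumes "tens_eq_upto N F F'" "tens_eq_upto N G G'"
  shows "tens_eq_upto N (F * G) (F' * G')"
  unfolding tens_eq_upto_def
proof (intro allI impI)
  fix S and R :: "nat \<Rightarrow>\<^sub>0 nat" assume R: "Poly_Mapping.keys R \<subseteq> {..<N}"
  show "ct_coeff (F * G) S R = ct_coeff (F' * G') S R"
    unfolding times_ctens.rep_eq
  proof (intro sum_pair_cong)
    fix S1 S2 R1 R2 assume "(R1, R2) \<in> poly_splits R"
    hence "Poly_Mapping.keys R1 \<subseteq> {..<N}" "Poly_Mapping.keys R2 \<subseteq> {..<N}"
      using keys_poly_splits R by blast+
    thus "shuffle_sign S1 S2 * ct_coeff F S1 R1 * twist (fcard S1) (ct_coeff G S2 R2) =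
        shuffle_sign S1 S2 * ct_coeff F' S1 R1 * twist (fcard S1) (ct_coeff G' S2 R2)"
      using assms by (simp add: tens_eq_upto_def)
  qed
qed

lemma tens_eq_upto_power:
  fixes F G :: "'a::comm_ring_1 ctens"
  assumes "tens_eq_upto N F G"
  shows "tens_eq_upto N (F ^ k) (G ^ k)"
  by (induction k) (simp add: tens_eq_upto_def, simp add: tens_eq_upto_mult assms)

text \<open>\<open>\<xi>\<^sub>j^q^a\<close> is \<open>\<xi>^xi_weight q a j\<close>; recall that \<open>\<xi>\<^sub>0 = 1\<close>.\<close>

definition xi_weight :: "nat \<Rightarrow> nat \<Rightarrow> nat \<Rightarrow> (nat \<Rightarrow>\<^sub>0 nat)" where
  "xi_weight q a j = (case j of 0 \<Rightarrow> 0 | Suc i \<Rightarrow> Poly_Mapping.single i (q ^ a))"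

lemma lookup_xi_weight: "Poly_Mapping.lookup (xi_weight q a j) l = (if j = Suc l then q ^ a else 0)"
  by (auto simp: xi_weight_def lookup_single when_def split: nat.split)

text \<open>Since \<open>q ^ a\<close> is nonzero, \<open>j\<close> can be read off from the
  position of the only nonzero entry, or from its absence when \<open>j = 0\<close>.\<close>

lemma xi_weight_inj:
  assumes "q > 0" shows "xi_weight q a i = xi_weight q a j \<longleftrightarrow> i = j"
proof
  assume *: "xi_weight q a i = xi_weight q a j"
  have "q ^ a \<noteq> 0" using assms by simp
  hence "i = Suc l \<longleftrightarrow> j = Suc l" for l
    using arg_cong[OF *, of "\<lambda>r. Poly_Mapping.lookup r l"] by (simp add: lookup_xi_weight split: if_splits)
  thus "i = j" by (metis not0_implies_Suc)
qed simp

lemma xi_eq_gmonom: "xi j = (gmonom 1 {||} (xi_weight q 0 j) :: 'p::prime_card gca)"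
  by (simp add: xi_def xi_weight_def even_gen_def one_eq_gmonom split: nat.split)

text \<open>The pure tensor \<open>y^b \<otimes> \<xi>^r\<close>; having no odd factor, it
  multiplies without Koszul signs.\<close>

definition even_tens :: "(nat \<Rightarrow>\<^sub>0 nat) \<Rightarrow> (nat \<Rightarrow>\<^sub>0 nat) \<Rightarrow> 'p::prime_card pol ctens" where
  "even_tens b r = gmonom 1 {||} b \<otimes>\<otimes> gmonom 1 {||} r"

lemma ct_coeff_even_tens:
  "ct_coeff (even_tens b r) S R = (if S = {||} \<and> R = r then gmonom 1 {||} b else 0)"
  by (auto simp: even_tens_def tens_def gcoeff_gmonom)

lemma twist_gmonom: "twist m (gmonom c {||} b) = gmonom c {||} b"
  by (rule ext_eqI) (auto simp: ext_coeff_twist gmonom_def ext_monom.rep_eq fcard_fempty)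

text \<open>A right factor without any \<open>\<tau>\<close> leaves all of \<open>S\<close> to the
  left factor, and its twist-invariant coefficients pass \<open>\<tau>\<^sub>S\<close> without
  sign.\<close>

lemma ct_coeff_mult_even:
  assumes "\<And>S R. S \<noteq> {||} \<Longrightarrow> ct_coeff G S R = 0" "\<And>R. twist (fcard S) (ct_coeff G {||} R) = ct_coeff G {||} R"
  shows "ct_coeff (F * G) S R = (\<Sum>(R1, R2)\<in>poly_splits R. ct_coeff F S R1 * ct_coeff G {||} R2)"
  unfolding times_ctens.rep_eq
  by (subst sum_splits_2) (simp_all add: assms case_prod_unfold)

lemma even_tens_mult: "even_tens b r * even_tens b' r' = (even_tens (b + b') (r + r') :: 'p::prime_card pol ctens)"
proof (rule ctens_eqI)
  fix S R
  have "ct_coeff (even_tens b r * even_tens b' r' :: 'p pol ctens) S R =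
      (\<Sum>(R1, R2)\<in>poly_splits R. ct_coeff (even_tens b r) S R1 * ct_coeff (even_tens b' r') {||} R2)"
    by (rule ct_coeff_mult_even) (auto simp: ct_coeff_even_tens twist_gmonom)
  also have "\<dots> = (\<Sum>z\<in>poly_splits R. if z = (r, r') then (if S = {||} then gmonom 1 {||} (b + b') else 0) else 0)"
    by (intro sum.cong refl) (auto simp: ct_coeff_even_tens gmonom_mult split: if_splits)
  also have "\<dots> = ct_coeff (even_tens (b + b') (r + r')) S R"
    by (subst sum.delta, rule finite_poly_splits)
       (cases "R = r + r'", simp_all add: ct_coeff_even_tens poly_splits_def)
  finally show "ct_coeff (even_tens b r * even_tens b' r' :: 'p pol ctens) S R = ct_coeff (even_tens (b + b') (r + r')) S R" .
qed

lemma even_tens_power: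
  "even_tens (Poly_Mapping.single i m) (xi_weight q 0 j) ^ (q ^ a) =
    (even_tens (Poly_Mapping.single i (m * q ^ a)) (xi_weight q a j) :: 'p::prime_card pol ctens)"
proof -
  \<comment> \<open>Induction needs arbitrary exponents \<open>k\<close>; the case expression
    extends \<open>xi_weight\<close> beyond powers of \<open>q\<close>.\<close>
  have "even_tens (Poly_Mapping.single i m) (xi_weight q 0 j) ^ k =
    (even_tens (Poly_Mapping.single i (m * k)) (case j of 0 \<Rightarrow> 0 | Suc l \<Rightarrow> Poly_Mapping.single l k) :: 'p pol ctens)" for k
  proof (induction k)
    case 0
    show ?case
      by (rule ctens_eqI, cases j) (simp_all add: ct_coeff_1 ct_coeff_even_tens flip: one_eq_gmonom)
  next
    case (Suc k)
    show ?case
      unfolding power_Suc Suc unfolding even_tens_mult mult_Suc_right single_add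
      by (cases j) (simp_all add: xi_weight_def flip: single_add)
  qed
  thus ?thesis by (simp add: xi_weight_def)
qed

text \<open>The integers act through the scalars from \<open>\<int>/p\<close>. This is the
  characteristic hypothesis of the Frobenius lemma.\<close>

lemma ctens_of_nat_card: "of_nat CARD('p) = (0 :: 'p::prime_card pol ctens)"
proof -
  have "of_nat n = (ct_scalar (of_nat n) :: 'p pol ctens)" for n
    by (induction n) (simp_all add: ct_scalar_add)
  thus ?thesis by simp
qed

text \<open>The term with \<open>j > 0\<close> involves the polynomial generator number
  \<open>j - 1\<close>, so terms with \<open>j > N\<close> do not reach exponents supported in
  \<open>{..<N}\<close>.\<close>

lemma coact_y_truncate:
  "tens_eq_upto N (coact_y i :: 'p::prime_card pol ctens)
     (\<Sum>j\<le>N. even_tens (Poly_Mapping.single i (CARD('p) ^ j)) (xi_weight CARD('p) 0 j))"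
  unfolding tens_eq_upto_def
proof (intro allI impI)
  fix S and R :: "nat \<Rightarrow>\<^sub>0 nat" assume R: "Poly_Mapping.keys R \<subseteq> {..<N}"
  let ?t = "\<lambda>j. even_tens (Poly_Mapping.single i (CARD('p) ^ j)) (xi_weight CARD('p) 0 j) :: 'p pol ctens"
  have eq: "hy i ^ (CARD('p) ^ s) \<otimes>\<otimes> xi s = ?t s" for s
    by (simp add: hy_power xi_eq_gmonom[of _ "CARD('p)"] even_tens_def)
  have sub: "{s. ct_coeff (?t s) S R \<noteq> 0} \<subseteq> {..N}"
  proof (intro subsetI)
    fix s assume "s \<in> {s. ct_coeff (?t s) S R \<noteq> 0}"
    hence "R = xi_weight CARD('p) 0 s" by (simp add: ct_coeff_even_tens split: if_splits)
    thus "s \<in> {..N}" using R by (cases s) (simp_all add: xi_weight_def)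
  qed
  have "ct_coeff (coact_y i :: 'p pol ctens) S R = (\<Sum>s | ct_coeff (?t s) S R \<noteq> 0. ct_coeff (?t s) S R)"
    by (simp add: coact_y_def ct_suminf_def eq)
  also have "\<dots> = (\<Sum>s\<le>N. ct_coeff (?t s) S R)"
    by (intro sum.mono_neutral_left sub) auto
  finally show "ct_coeff (coact_y i :: 'p pol ctens) S R = ct_coeff (\<Sum>j\<le>N. ?t j) S R" by simp
qed

text \<open>The Frobenius is applied to a truncation that depends on \<open>R\<close>. By
  \<open>xi_weight_inj\<close> at most one term contributes to \<open>R\<close>, namely the one
  picked by \<open>THE\<close>.\<close>

lemma ct_coeff_coact_y_power:
  "ct_coeff (coact_y i ^ (CARD('p) ^ a) :: 'p::prime_card pol ctens) S R =
    (if S = {||} \<and> (\<exists>j. R = xi_weight CARD('p) a j)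
     then hy i ^ (CARD('p) ^ (a + (THE j. R = xi_weight CARD('p) a j))) else 0)"
proof -
  let ?q = "CARD('p)"
  let ?t = "\<lambda>j. even_tens (Poly_Mapping.single i (?q ^ j)) (xi_weight ?q 0 j) :: 'p pol ctens"
  have q0: "?q > 0" by simp
  obtain N where N: "Poly_Mapping.keys R \<subseteq> {..<N}"
    using gsupp_bound[of "{({||}, R)}"] by auto
  have "ct_coeff (coact_y i ^ (?q ^ a) :: 'p pol ctens) S R = ct_coeff ((\<Sum>j\<le>N. ?t j) ^ (?q ^ a)) S R"
    using tens_eq_upto_power[OF coact_y_truncate[where ?'p = 'p, of N i], of "?q ^ a"] N by (simp add: tens_eq_upto_def)
  also have "(\<Sum>j\<le>N. ?t j) ^ (?q ^ a) = (\<Sum>j\<le>N. ?t j ^ (?q ^ a))"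
    by (rule commuting_freshmans_dream_sum)
       (simp_all add: even_tens_mult add.commute prime_card ctens_of_nat_card del: of_nat_card_eq_0)
  also have "\<dots> = (\<Sum>j\<le>N. even_tens (Poly_Mapping.single i (?q ^ (a + j))) (xi_weight ?q a j))"
    by (simp add: even_tens_power power_add mult.commute)
  also have "ct_coeff \<dots> S R =
      (\<Sum>j\<le>N. if S = {||} \<and> R = xi_weight ?q a j then hy i ^ (?q ^ (a + j)) else 0)"
    by (simp add: ct_coeff_even_tens hy_power cong: if_cong)
  also have "\<dots> = (if S = {||} \<and> (\<exists>j. R = xi_weight ?q a j)
     then hy i ^ (?q ^ (a + (THE j. R = xi_weight ?q a j))) else 0)"
  proof (cases "S = {||} \<and> (\<exists>j. R = xi_weight ?q a j)")
    case True
    then obtain j where j: "R = xi_weight ?q a j" by auto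
    have "j \<le> N" using N unfolding j by (auto simp: xi_weight_def split: nat.splits if_splits)
    moreover have "(THE j'. R = xi_weight ?q a j') = j"
      using j xi_weight_inj[OF q0] by auto
    moreover have "R = xi_weight ?q a j' \<longleftrightarrow> j' = j" for j'
      using j xi_weight_inj[OF q0] by auto
    ultimately show ?thesis using True by simp
  next
    case False
    thus ?thesis by (auto intro!: sum.neutral)
  qed
  finally show ?thesis .
qed

lemma ct_coeff_mult_coact_y_power:
  "ct_coeff (F * coact_y i ^ (CARD('p) ^ a) :: 'p::prime_card pol ctens) S R =
    (\<Sum>(R1, R2)\<in>poly_splits R. ct_coeff F S R1 * ct_coeff (coact_y i ^ (CARD('p) ^ a)) {||} R2)"
  by (rule ct_coeff_mult_even) (auto simp: ct_coeff_coact_y_power hy_power twist_gmonom)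

lemma ct_coeff_coact_x:
  "ct_coeff (coact_x i :: 'p::prime_card pol ctens) S R =
    (if R = 0 \<and> S = {||} then hx i
     else if R = 0 \<and> (\<exists>s. S = {|s|}) then hy i ^ (CARD('p) ^ (THE s. S = {|s|})) else 0)"
proof -
  have 1: "ct_coeff (hy i ^ (CARD('p) ^ s) \<otimes>\<otimes> tau s :: 'p pol ctens) S R =
      (if R = 0 \<and> S = {|s|} then hy i ^ (CARD('p) ^ s) else 0)" for s
    by (auto simp: tens_def tau_def odd_gen_def gcoeff_gmonom)
  \<comment> \<open>Needed because \<open>ct_suminf\<close> sums over the indices with nonzero
    coefficient.\<close>
  have 2: "hy i ^ k \<noteq> (0 :: 'p gca)" for k
  proof
    assume "hy i ^ k = (0 :: 'p gca)"
    hence "gcoeff (hy i ^ k :: 'p gca) {||} (Poly_Mapping.single i k) = 0" by simp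
    thus False by (simp add: hy_power gcoeff_gmonom)
  qed
  have 3: "ct_coeff (hx i \<otimes>\<otimes> 1 :: 'p pol ctens) S R = (if R = 0 \<and> S = {||} then hx i else 0)"
    by (auto simp: tens_def gcoeff_1)
  have "{s. R = 0 \<and> S = {|s|}} = (if R = 0 \<and> (\<exists>s. S = {|s|}) then {THE s. S = {|s|}} else {})"
    by auto
  thus ?thesis
    unfolding coact_x_def ct_coeff_add 3 ct_suminf_def ct_coeff_Abs 1 by (auto simp: 2)
qed

lemma twist_hx: "twist m (hx i) = (- 1) ^ m * (hx i :: 'p::prime_card gca)"
proof -
  have "(- 1) ^ m * (hx i :: 'p gca) = (if even m then hx i else - hx i)" by auto
  thus ?thesis
    by (intro ext_eqI)
       (auto simp: ext_coeff_twist hx_def odd_gen_def gmonom_def ext_monom.rep_eq fcard_finsert_if fcard_fempty)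
qed

text \<open>From \<open>\<lambda>(x\<^sub>i)\<close> comes either
  \<open>x\<^sub>i \<otimes> 1\<close>, where the odd \<open>x\<^sub>i\<close> moves past
  \<open>\<tau>\<^sub>S\<close>, or \<open>y\<^sub>i^p^s \<otimes> \<tau>\<^sub>s\<close> with
  \<open>s\<close> in \<open>S\<close>, where \<open>y\<^sub>i\<close> is even and only the sign for
  sorting \<open>\<tau>\<^sub>s\<close> into place remains.\<close>

lemma ct_coeff_mult_coact_x:
  assumes "sorted_wrt (<) S"
  shows "ct_coeff (F * coact_x i :: 'p::prime_card pol ctens) (fset_of_list S) R =
    (- 1) ^ length S * ct_coeff F (fset_of_list S) R * hx i +
    altsum (\<lambda>s T. ct_coeff F (fset_of_list T) R * hy i ^ (CARD('p) ^ s)) S"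
proof -
  let ?K = "fset_of_list S" and ?X = "coact_x i :: 'p pol ctens"
  have len: "fcard ?K = length S"
    using assms by (simp add: fcard.rep_eq fset_of_list.rep_eq distinct_card strict_sorted_iff)
  define h where "h S1 S2 = shuffle_sign S1 S2 * ct_coeff F S1 R * twist (fcard S1) (ct_coeff ?X S2 0)" for S1 S2
  have "ct_coeff (F * ?X) ?K R = (\<Sum>(S1, S2)\<in>splits ?K. h S1 S2)"
    unfolding times_ctens.rep_eq h_def
    by (intro sum_pair_cong, subst sum_poly_splits_2) (auto simp: ct_coeff_coact_x)
  also have "\<dots> = (\<Sum>(S1, S2)\<in>insert (?K, {||}) ((\<lambda>s. (?K |-| {|s|}, {|s|})) ` set S). h S1 S2)"
  proof (intro sum.mono_neutral_right ballI)
    fix z assume z: "z \<in> splits ?K - insert (?K, {||}) ((\<lambda>s. (?K |-| {|s|}, {|s|})) ` set S)"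
    obtain S1 S2 where z': "z = (S1, S2)" by force
    have "S2 \<noteq> {||}" using z z' by (auto simp: splits_def)
    moreover have "S2 \<noteq> {|s|}" for s
    proof
      assume s: "S2 = {|s|}"
      hence "s |\<in>| ?K" "S1 = ?K |-| {|s|}" using z z' by (auto simp: splits_def)
      thus False using z z' s by (auto simp: fset_of_list_elem)
    qed
    ultimately show "(case z of (S1, S2) \<Rightarrow> h S1 S2) = 0"
      by (simp add: z' h_def ct_coeff_coact_x)
  next
    show "finite (splits ?K)" by simp
  qed (auto simp: splits_def fset_of_list_elem)
  also have "\<dots> = h ?K {||} + (\<Sum>s\<in>set S. h (?K |-| {|s|}) {|s|})"
    by (subst sum.insert) (auto simp: sum.reindex inj_on_def)
  also have "h ?K {||} = (- 1) ^ length S * ct_coeff F ?K R * hx i"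
    by (simp add: h_def ct_coeff_coact_x twist_hx len minus_one_power_left_commute mult.assoc)
  also have "(\<Sum>s\<in>set S. h (?K |-| {|s|}) {|s|}) =
      altsum (\<lambda>s T. ct_coeff F (fset_of_list T) R * hy i ^ (CARD('p) ^ s)) S"
    unfolding altsum_conv_sorted[OF assms, of "\<lambda>s T. ct_coeff F T R * hy i ^ (CARD('p) ^ s)"]
    by (intro sum.cong refl) (simp add: h_def ct_coeff_coact_x hy_power twist_gmonom mult.assoc)
  finally show ?thesis .
qed

section \<open>The coaction on Mui invariants\<close>

lemma sum_powers_less:
  fixes q :: nat
  assumes "q \<ge> 2" "A \<subseteq> {..<N}"
  shows "(\<Sum>a\<in>A. q ^ a) < q ^ N"
proof -
  have "(\<Sum>a<N. q ^ a) < q ^ N"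
  proof (induction N)
    case (Suc N)
    have "2 * q ^ N \<le> q ^ Suc N" using assms(1) by simp
    thus ?case unfolding sum.lessThan_Suc using Suc by linarith
  qed simp
  moreover have "(\<Sum>a\<in>A. q ^ a) \<le> (\<Sum>a<N. q ^ a)"
    using assms(2) by (intro sum_mono2) auto
  ultimately show ?thesis by simp
qed

text \<open>Uniqueness of expansions with digits 0 and 1: the top power exceeds any sum of distinct
  lower ones, so both sets have the same largest element, which is then removed.\<close>

lemma sum_powers_inj:
  fixes q :: nat
  assumes "q \<ge> 2" "finite A" "finite B" "(\<Sum>a\<in>A. q ^ a) = (\<Sum>a\<in>B. q ^ a)"
  shows "A = B"
proof -
  have *: "N \<in> B" if "A \<subseteq> {..<Suc N}" "B \<subseteq> {..<Suc N}" "N \<in> A" "(\<Sum>a\<in>A. q ^ a) = (\<Sum>a\<in>B. q ^ a)" for N A B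
  proof (rule ccontr)
    assume "N \<notin> B"
    hence "B \<subseteq> {..<N}" using that(2) by (auto simp: less_Suc_eq)
    hence "(\<Sum>a\<in>B. q ^ a) < q ^ N" using assms(1) by (intro sum_powers_less)
    moreover have "q ^ N \<le> (\<Sum>a\<in>A. q ^ a)"
      using that(1,3) finite_subset[OF that(1)] by (intro member_le_sum) auto
    ultimately show False using that(4) by simp
  qed
  have "A = B" if "A \<subseteq> {..<N}" "B \<subseteq> {..<N}" "(\<Sum>a\<in>A. q ^ a) = (\<Sum>a\<in>B. q ^ a)" for N
    using that
  proof (induction N arbitrary: A B)
    case (Suc N)
    have fin: "finite A" "finite B" using Suc.prems finite_subset by blast+
    have iff: "N \<in> A \<longleftrightarrow> N \<in> B" using *[of A N B] *[of B N A] Suc.prems by auto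
    have "(\<Sum>a\<in>A - {N}. q ^ a) = (\<Sum>a\<in>B - {N}. q ^ a)"
      using Suc.prems(3) iff fin by (cases "N \<in> A") (simp_all add: sum.remove)
    hence "A - {N} = B - {N}"
      using Suc.prems by (intro Suc.IH) (auto simp: less_Suc_eq)
    thus ?case using iff by blast
  qed simp
  moreover obtain N where "A \<union> B \<subseteq> {..<N}"
    using assms(2,3) finite_nat_bounded[of "A \<union> B"] by auto
  ultimately show ?thesis using assms(4) by auto
qed

text \<open>The exponent of the product over \<open>a\<close> in \<open>A\<close> of
  \<open>\<xi>\<^sub>j^q^a\<close> with \<open>j = f a\<close>. Here \<open>f\<close> takes the
  values \<open>a = e i\<close> as arguments rather than the indices \<open>i\<close>.\<close>

definition xi_exponent :: "nat \<Rightarrow> nat set \<Rightarrow> (nat \<Rightarrow> nat) \<Rightarrow> (nat \<Rightarrow>\<^sub>0 nat)" where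
  "xi_exponent q A f = (\<Sum>a\<in>A. xi_weight q a (f a))"

lemma lookup_xi_exponent:
  "finite A \<Longrightarrow> Poly_Mapping.lookup (xi_exponent q A f) l = (\<Sum>a | a \<in> A \<and> f a = Suc l. q ^ a)"
  by (simp add: xi_exponent_def lookup_sum lookup_xi_weight sum.inter_filter)

text \<open>The digits of entry \<open>l\<close> recover the fibre of \<open>f\<close> over
  \<open>Suc l\<close>. The fibre over 0 leaves no trace, as \<open>\<xi>\<^sub>0 = 1\<close>, but
  it is the complement of the others.\<close>

lemma xi_exponent_inj:
  assumes "q \<ge> 2" "finite A" "xi_exponent q A f = xi_exponent q A g" "a \<in> A"
  shows "f a = g a"
proof -
  have "{a \<in> A. f a = Suc l} = {a \<in> A. g a = Suc l}" for l
    using assms(1,2) arg_cong[OF assms(3), of "\<lambda>r. Poly_Mapping.lookup r l"]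
    by (intro sum_powers_inj[of q]) (simp_all add: lookup_xi_exponent)
  hence "f a = Suc l \<longleftrightarrow> g a = Suc l" for l using assms(4) by blast
  thus ?thesis by (metis not0_implies_Suc)
qed

text \<open>\<open>mui_rec n as\<close> is \<open>[n - length as; as]\<close> if \<open>length as \<le> n\<close>, and 0 otherwise.\<close>

primrec mui_rec :: "nat \<Rightarrow> nat list \<Rightarrow> 'p::prime_card gca" where
  "mui_rec 0 as = (if as = [] then 1 else 0)"
| "mui_rec (Suc n) as = (- 1) ^ length as * (mui_rec n as * hx (Suc n)) +
     altsum (\<lambda>a bs. mui_rec n bs * hy (Suc n) ^ (CARD('p) ^ a)) as"

text \<open>Each step of the recursion uses up one variable and removes at most one entry of the
  list.\<close>

lemma mui_rec_too_long: "length as > n \<Longrightarrow> mui_rec n as = 0"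
proof (induction n arbitrary: as)
  case (Suc n)
  have "altsum (\<lambda>a bs. mui_rec n bs * hy (Suc n) ^ (CARD('a) ^ a)) as = altsum (\<lambda>a bs. (0 :: 'a gca)) as"
    using Suc by (intro altsum_cong) simp
  thus ?case using Suc by (simp add: altsum_zero)
qed auto

lemma coaction_uminus: "coaction (- u) = - coaction u"
  using coaction_add[of u "- u"] by (simp add: eq_neg_iff_add_eq_0 add.commute)

lemma coaction_power:
  assumes "odd CARD('p::prime_card)"
  shows "coaction (u ^ k :: 'p gca) = coaction u ^ k"
  by (induction k) (simp_all add: coaction_1 coaction_mult[OF assms])

lemma ct_coeff_minus_one_power: "ct_coeff ((- 1) ^ k * F) S R = (- 1) ^ k * ct_coeff F S R"
  by (cases "even k") auto

lemma coaction_mui_rec_Suc: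
  assumes "odd CARD('p::prime_card)"
  shows "coaction (mui_rec (Suc n) as :: 'p gca) =
    (- 1) ^ length as * (coaction (mui_rec n as) * coact_x (Suc n)) +
    altsum (\<lambda>a bs. coaction (mui_rec n bs) * coact_y (Suc n) ^ (CARD('p) ^ a)) as"
proof -
  have "coaction ((- 1) ^ k * u) = (- 1) ^ k * (coaction u :: 'p pol ctens)" for k u
    by (cases "even k") (auto simp: coaction_uminus)
  moreover have "coaction (altsum f as) = altsum (\<lambda>a bs. coaction (f a bs :: 'p gca)) as" for f
    by (rule altsum_hom) (simp_all add: coaction_add coaction_uminus)
  ultimately show ?thesis
    by (simp add: coaction_add coaction_mult[OF assms] coaction_power[OF assms] coaction_hx coaction_hy
        coaction_uminus coaction_1)
qed

text \<open>Induction on the number of variables, with \<open>S\<close>, \<open>es\<close> and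
  \<open>R\<close> arbitrary; both sides obey the same expansion along the last variable. Vanishing
  is proved alongside because it discards all but one of the splittings of \<open>R\<close> in a
  product with a power of \<open>coact_y\<close>.\<close>

lemma ct_coeff_coaction_mui_rec:
  assumes p: "odd CARD('p::prime_card)" and "sorted_wrt (<) S" "distinct es"
  shows "(\<forall>f. R = xi_exponent CARD('p) (set es) f \<longrightarrow>
      ct_coeff (coaction (mui_rec n es :: 'p gca)) (fset_of_list S) R = mui_rec n (S @ map (\<lambda>a. a + f a) es)) \<and>
    ((\<nexists>f. R = xi_exponent CARD('p) (set es) f) \<longrightarrow>
      ct_coeff (coaction (mui_rec n es :: 'p gca)) (fset_of_list S) R = 0)"
  using assms(2,3)
proof (induction n arbitrary: S es R)
  case 0
  have "fset_of_list S = {||} \<longleftrightarrow> S = []"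
    by (cases S) auto
  thus ?case by (auto simp: coaction_1 ct_coeff_1 xi_exponent_def)
next
  case (Suc n)
  let ?q = "CARD('p)" and ?K = "fset_of_list S"
  have q: "?q \<ge> 2" using prime_card[where ?'a = 'p] by (rule prime_ge_2_nat)
  define C :: "nat list \<Rightarrow> nat list \<Rightarrow> (nat \<Rightarrow>\<^sub>0 nat) \<Rightarrow> 'p gca"
    where "C es S R = ct_coeff (coaction (mui_rec n es)) (fset_of_list S) R" for es S R
  \<comment> \<open>The contribution of the summand in which \<open>y^p^a\<close> is split off the
    determinant.\<close>
  define Y where "Y a bs = (\<Sum>(R1, R2)\<in>poly_splits R.
      C bs S R1 * ct_coeff (coact_y (Suc n) ^ (?q ^ a)) {||} R2)" for a bs
  have IH1: "C es S (xi_exponent ?q (set es) f) = mui_rec n (S @ map (\<lambda>a. a + f a) es)"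
    if "sorted_wrt (<) S" "distinct es" for S es f
    using Suc.IH[OF that] unfolding C_def by blast
  have IH2: "C es S R = 0" if "sorted_wrt (<) S" "distinct es" "\<nexists>f. R = xi_exponent ?q (set es) f" for S es R
    using Suc.IH[OF that(1,2)] that(3) unfolding C_def by blast
  have C_altsum: "ct_coeff (altsum g es) ?K R = altsum (\<lambda>a bs. ct_coeff (g a bs) ?K R) es" 
    for g :: "nat \<Rightarrow> nat list \<Rightarrow> 'p pol ctens"
    by (rule altsum_hom[where h = "\<lambda>F. ct_coeff F ?K R"]) simp_all
  have "ct_coeff (coaction (mui_rec (Suc n) es :: 'p gca)) ?K R =
      (- 1) ^ length es * ((- 1) ^ length S * C es S R * hx (Suc n) +
        altsum (\<lambda>s T. C es T R * hy (Suc n) ^ (?q ^ s)) S) + altsum Y es"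
    unfolding coaction_mui_rec_Suc[OF p] Y_def C_def ct_coeff_add ct_coeff_minus_one_power
      C_altsum ct_coeff_mult_coact_x[OF Suc.prems(1)] ct_coeff_mult_coact_y_power ..
  note expand = this
  have S_pick: "sorted_wrt (<) (xs @ ys)" if "S = xs @ s # ys" for xs s ys
    using Suc.prems(1) that by (auto simp: sorted_wrt_append)
  have es_pick: "distinct (xs @ ys)" "set es = insert a (set (xs @ ys))" "a \<notin> set (xs @ ys)"
    if "es = xs @ a # ys" for xs a ys
    using Suc.prems(2) that by auto
  have Y_term: "\<exists>f. R1 = xi_exponent ?q (set (xs @ ys)) f \<and> R2 = xi_weight ?q a (f a) \<and>
      R = xi_exponent ?q (set es) f"
    if es: "es = xs @ a # ys" and R: "(R1, R2) \<in> poly_splits R"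
      and nz: "C (xs @ ys) S R1 * ct_coeff (coact_y (Suc n) ^ (?q ^ a)) {||} R2 \<noteq> (0 :: 'p gca)" for xs a ys R1 R2
  proof -
    have "C (xs @ ys) S R1 \<noteq> 0" using nz by auto
    then obtain f where f: "R1 = xi_exponent ?q (set (xs @ ys)) f"
      using IH2[OF Suc.prems(1) es_pick(1)[OF es]] by blast
    obtain j where j: "R2 = xi_weight ?q a j"
      using nz by (auto simp: ct_coeff_coact_y_power split: if_splits)
    \<comment> \<open>The data from \<open>R1\<close> and \<open>R2\<close> glue to one function, as
      \<open>a\<close> does not occur in the remaining list.\<close>
    have "R1 = xi_exponent ?q (set (xs @ ys)) (f(a := j))"
      unfolding f xi_exponent_def using es_pick(3)[OF es] by (intro sum.cong) auto
    moreover from this have "R = xi_exponent ?q (set es) (f(a := j))"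
      unfolding es_pick(2)[OF es] xi_exponent_def
      using R es_pick(3)[OF es] j by (simp add: poly_splits_def add.commute)
    ultimately show ?thesis using j by (intro exI[of _ "f(a := j)"]) simp
  qed
  show ?case
  proof (intro conjI allI impI)
    assume none: "\<nexists>f. R = xi_exponent ?q (set es) f"
    have "Y a (xs @ ys) = 0" if "es = xs @ a # ys" for xs a ys
      unfolding Y_def case_prod_unfold
    proof (intro sum.neutral ballI)
      fix z assume "z \<in> poly_splits R"
      thus "C (xs @ ys) S (fst z) * ct_coeff (coact_y (Suc n) ^ (?q ^ a)) {||} (snd z) = (0 :: 'p gca)"
        using Y_term[OF that, of "fst z" "snd z"] none by auto
    qed
    hence "altsum Y es = altsum (\<lambda>_ _. 0) es" by (intro altsum_cong)
    moreover have "C es T R = 0" if "sorted_wrt (<) T" for T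
      using IH2[OF that Suc.prems(2) none] .
    moreover from this have "altsum (\<lambda>s T. C es T R * hy (Suc n) ^ (?q ^ s)) S = altsum (\<lambda>_ _. 0) S"
      using S_pick by (intro altsum_cong) simp
    ultimately show "ct_coeff (coaction (mui_rec (Suc n) es :: 'p gca)) ?K R = 0"
      unfolding expand using Suc.prems(1) by (simp add: altsum_zero)
  next
    fix f assume R: "R = xi_exponent ?q (set es) f"
    let ?g = "\<lambda>a. a + f a"
    have Y: "Y a (xs @ ys) = mui_rec n (S @ map ?g (xs @ ys)) * hy (Suc n) ^ (?q ^ ?g a)"
      if es: "es = xs @ a # ys" for xs a ys
    proof -
      let ?R1 = "xi_exponent ?q (set (xs @ ys)) f" and ?R2 = "xi_weight ?q a (f a)"
      let ?h = "\<lambda>(R1, R2). C (xs @ ys) S R1 * ct_coeff (coact_y (Suc n) ^ (?q ^ a)) {||} R2"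
      have "Y a (xs @ ys) = (\<Sum>z\<in>{(?R1, ?R2)}. ?h z)"
        unfolding Y_def
      proof (intro sum.mono_neutral_right ballI)
        show "{(?R1, ?R2)} \<subseteq> poly_splits R"
          using es_pick(3)[OF es] unfolding R es_pick(2)[OF es]
          by (simp add: poly_splits_def xi_exponent_def add.commute)
        fix z assume z: "z \<in> poly_splits R - {(?R1, ?R2)}"
        obtain R1 R2 where z': "z = (R1, R2)" by force
        show "?h z = 0"
        proof (rule ccontr)
          assume "?h z \<noteq> 0"
          then obtain f' where f': "R1 = xi_exponent ?q (set (xs @ ys)) f'" "R2 = xi_weight ?q a (f' a)"
            "R = xi_exponent ?q (set es) f'"
            using Y_term[OF es, of R1 R2] z z' by auto
          \<comment> \<open>Any contributing splitting arises from some \<open>f'\<close> with the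
            same total exponent \<open>R\<close>; uniqueness of digits makes it the expected
            one.\<close>
          have eq: "f' b = f b" if "b \<in> set es" for b
            using xi_exponent_inj[OF q _ _ that] R f'(3) by auto
          have "R1 = ?R1" unfolding f'(1) xi_exponent_def
            using eq es by (intro sum.cong) auto
          moreover have "R2 = ?R2" using f'(2) eq es by simp
          ultimately show False using z z' by simp
        qed
      qed simp
      also have "(THE j. ?R2 = xi_weight ?q a j) = f a"
        using xi_weight_inj[of ?q a] by auto
      hence "(\<Sum>z\<in>{(?R1, ?R2)}. ?h z) = mui_rec n (S @ map ?g (xs @ ys)) * hy (Suc n) ^ (?q ^ ?g a)"
        using IH1[OF Suc.prems(1) es_pick(1)[OF es], of f]
        by (auto simp: ct_coeff_coact_y_power)
      finally show ?thesis .
    qed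
    have "altsum Y es = altsum (\<lambda>a bs. mui_rec n (S @ map ?g bs) * hy (Suc n) ^ (?q ^ ?g a)) es"
      using Y by (intro altsum_cong)
    hence "altsum Y es = altsum (\<lambda>b bs. mui_rec n (S @ bs) * hy (Suc n) ^ (?q ^ b)) (map ?g es)"
      by (simp add: altsum_map)
    moreover have CR: "C es T R = mui_rec n (T @ map ?g es)" if "sorted_wrt (<) T" for T
      unfolding R by (rule IH1[OF that Suc.prems(2)])
    moreover from this have "altsum (\<lambda>s T. C es T R * hy (Suc n) ^ (?q ^ s)) S =
        altsum (\<lambda>s T. mui_rec n (T @ map ?g es) * hy (Suc n) ^ (?q ^ s)) S"
      using S_pick by (intro altsum_cong) simp
    \<comment> \<open>By \<open>altsum_append\<close>, picks from \<open>S\<close> carry the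
      additional sign \<open>(- 1) ^ length es\<close>; in the \<open>x\<close> term the two signs
      combine to that of the full list.\<close>
    ultimately show "ct_coeff (coaction (mui_rec (Suc n) es :: 'p gca)) ?K R = mui_rec (Suc n) (S @ map ?g es)"
      unfolding expand using Suc.prems(1)
      by (simp add: altsum_append power_add mult.assoc distrib_left)
         (simp add: mult.assoc[symmetric] power_add[symmetric] add.commute add.assoc)
  qed
qed

section \<open>Homogeneity\<close>

text \<open>The sign in \<open>steenrod_act\<close> depends on the degree, which must therefore be
  known for Mui's invariants. Zero has every degree.\<close>

definition homogeneous :: "nat \<Rightarrow> 'p::prime_card gca \<Rightarrow> bool" where
  "homogeneous d u \<longleftrightarrow> (\<forall>I a. gcoeff u I a \<noteq> 0 \<longrightarrow> hdim I a = d)"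

lemma hcomp_homogeneous:
  assumes "homogeneous d u"
  shows "hcomp d u = u"
proof -
  have "{(I, a) \<in> gsupp u. hdim I a = d} = gsupp u"
    using assms by (auto simp: homogeneous_def gsupp_def)
  thus ?thesis unfolding hcomp_def using gca_decomp[of "gsupp u" u] by simp
qed

lemma gcoeff_uminus: "gcoeff (- u) I a = - gcoeff u I a"
  by (simp add: gcoeff_def)

lemma homogeneous_0: "homogeneous d 0"
  by (simp add: homogeneous_def)

lemma homogeneous_1: "homogeneous 0 1"
  by (simp add: homogeneous_def gcoeff_1 hdim_def fcard_fempty)

lemma homogeneous_add: "homogeneous d u \<Longrightarrow> homogeneous d v \<Longrightarrow> homogeneous d (u + v)"
  unfolding homogeneous_def by (metis add.right_neutral gcoeff_add)

lemma homogeneous_minus_one_power: "homogeneous d u \<Longrightarrow> homogeneous d ((- 1) ^ k * u)"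
  by (cases "even k") (auto simp: homogeneous_def gcoeff_uminus)

lemma homogeneous_sum: "(\<And>z. z \<in> A \<Longrightarrow> homogeneous d (f z)) \<Longrightarrow> homogeneous d (sum f A)"
  by (induction A rule: infinite_finite_induct) (simp_all add: homogeneous_0 homogeneous_add)

lemma hdim_add:
  assumes "I |\<inter>| J = {||}"
  shows "hdim (I |\<union>| J) (a + b) = hdim I a + hdim J b"
proof -
  let ?K = "Poly_Mapping.keys a \<union> Poly_Mapping.keys b"
  have sub: "Poly_Mapping.keys (a + b) \<subseteq> ?K" by (rule Poly_Mapping.keys_add)
  have "(\<Sum>i\<in>Poly_Mapping.keys c. Poly_Mapping.lookup c i) = (\<Sum>i\<in>?K. Poly_Mapping.lookup c i)"
    if "Poly_Mapping.keys c \<subseteq> ?K" for c :: "nat \<Rightarrow>\<^sub>0 nat"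
    using that by (intro sum.mono_neutral_left) (auto simp: in_keys_iff)
  from this[of a] this[of b] this[OF sub] show ?thesis
    by (simp add: hdim_def lookup_add sum.distrib fcard_funion_disjoint assms)
qed

lemma homogeneous_mult:
  assumes "homogeneous d u" "homogeneous d' v"
  shows "homogeneous (d + d') (u * v)"
proof -
  let ?m = "\<lambda>u z. gmonom (gcoeff u (fst z) (snd z)) (fst z) (snd z)"
  have "u * v = (\<Sum>z\<in>gsupp u. \<Sum>w\<in>gsupp v. ?m u z * ?m v w)"
    using gca_decomp[of "gsupp u" u] gca_decomp[of "gsupp v" v]
    by (simp add: case_prod_unfold flip: sum_product)
  moreover have "homogeneous (d + d') (?m u z * ?m v w)" if "z \<in> gsupp u" "w \<in> gsupp v" for z w
  proof -
    have "hdim (fst z) (snd z) = d" "hdim (fst w) (snd w) = d'"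
      using that assms by (auto simp: homogeneous_def gsupp_def)
    thus ?thesis
      by (auto simp: homogeneous_def gmonom_mult gcoeff_gmonom hdim_add)
  qed
  ultimately show ?thesis by (simp add: homogeneous_sum)
qed

lemma homogeneous_hx: "homogeneous 1 (hx i)"
  by (auto simp: homogeneous_def hx_def odd_gen_def gcoeff_gmonom hdim_def fcard_finsert_if fcard_fempty)

lemma homogeneous_hy_power: "homogeneous (2 * k) (hy i ^ k)"
  by (auto simp: homogeneous_def hy_power gcoeff_gmonom hdim_def fcard_fempty)

lemma homogeneous_altsum:
  "(\<And>xs a ys. as = xs @ a # ys \<Longrightarrow> homogeneous d (f a (xs @ ys))) \<Longrightarrow> homogeneous d (altsum f as)"
  unfolding altsum_conv_sum by (intro homogeneous_sum homogeneous_minus_one_power) (simp add: id_take_nth_drop)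

text \<open>There are \<open>n - length as\<close> odd factors of degree 1 and one factor of degree
  \<open>2 * p ^ a\<close> for each entry \<open>a\<close>. Subtracting last avoids truncation,
  since every power is at least 1.\<close>

lemma homogeneous_mui_rec:
  "homogeneous (n + 2 * (\<Sum>a\<leftarrow>as. CARD('p) ^ a) - length as) (mui_rec n as :: 'p::prime_card gca)"
proof (induction n arbitrary: as)
  case 0
  thus ?case by (auto simp: homogeneous_0 homogeneous_1)
next
  case (Suc n)
  let ?s = "\<lambda>as. \<Sum>a\<leftarrow>as. CARD('p) ^ a"
  let ?d = "\<lambda>n as. n + 2 * ?s as - length as"
  have le: "length as \<le> ?s as" for as :: "nat list"
  proof (induction as)
    case (Cons a as)
    moreover have "CARD('p) ^ a \<ge> 1" by simp
    ultimately show ?case by (simp del: One_nat_def)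
  qed simp
  have "homogeneous (?d n as + 1) (mui_rec n as * hx (Suc n) :: 'p gca)"
    by (intro homogeneous_mult Suc homogeneous_hx)
  moreover have "?d n as + 1 = ?d (Suc n) as" using le[of as] by simp
  moreover have "homogeneous (?d (Suc n) as) (mui_rec n (xs @ ys) * hy (Suc n) ^ (CARD('p) ^ a) :: 'p gca)"
    if as: "as = xs @ a # ys" for xs a ys
  proof -
    have "homogeneous (?d n (xs @ ys) + 2 * CARD('p) ^ a) (mui_rec n (xs @ ys) * hy (Suc n) ^ (CARD('p) ^ a) :: 'p gca)"
      by (intro homogeneous_mult Suc homogeneous_hy_power)
    moreover have "?d n (xs @ ys) + 2 * CARD('p) ^ a = ?d (Suc n) as"
      using le[of "xs @ ys"] unfolding as by simp
    ultimately show ?thesis by simp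
  qed
  ultimately show ?case
    by (auto intro!: homogeneous_add homogeneous_minus_one_power homogeneous_altsum)
qed

section \<open>Expansion of Mui invariants in the last variable\<close>

definition list_perm :: "nat list \<Rightarrow> nat \<Rightarrow> nat" where
  "list_perm xs j = (if j \<in> {1..length xs} then xs ! (j - 1) else j)"

lemma list_perm_permutation:
  assumes "distinct xs" "set xs = {1..length xs}"
  shows "permutation (list_perm xs)"
proof -
  have "bij_betw (\<lambda>j. j - 1) {1..length xs} {..<length xs}"
    by (rule bij_betw_byWitness[of _ Suc]) auto
  hence "bij_betw ((!) xs \<circ> (\<lambda>j. j - 1)) {1..length xs} {1..length xs}"
    by (rule bij_betw_trans) (rule bij_betw_nth, use assms in auto)
  hence "bij_betw (list_perm xs) {1..length xs} {1..length xs}"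
    by (subst bij_betw_cong[of _ _ "(!) xs \<circ> (\<lambda>j. j - 1)"]) (auto simp: list_perm_def)
  hence "list_perm xs permutes {1..length xs}"
    by (rule bij_imp_permutes) (auto simp: list_perm_def)
  thus ?thesis unfolding permutation_permutes by blast
qed

lemma sign_list_perm_move_last:
  assumes "distinct (xs @ a # ys)" "set (xs @ a # ys) = {1..length (xs @ a # ys)}"
  shows "sign (list_perm (xs @ a # ys)) = (- 1) ^ length ys * sign (list_perm (xs @ ys @ [a]))"
  using assms
proof (induction ys arbitrary: xs)
  case (Cons y ys)
  \<comment> \<open>Swapping \<open>a\<close> with its right neighbour; positions are counted from
    1.\<close>
  let ?t = "transpose (Suc (length xs)) (Suc (Suc (length xs)))"
  have "list_perm (xs @ a # y # ys) j = (list_perm ((xs @ [y]) @ a # ys) \<circ> ?t) j" for j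
  proof -
    consider "j \<le> length xs" | "j = Suc (length xs)" | "j = Suc (Suc (length xs))" | "j > Suc (Suc (length xs))"
      by linarith
    thus ?thesis
    proof cases
      case 4
      then obtain i where "j = Suc (Suc (Suc (length xs + i)))"
        by (auto simp: less_iff_Suc_add)
      thus ?thesis by (simp add: list_perm_def nth_append transpose_def)
    qed (auto simp: list_perm_def nth_append transpose_def)
  qed
  hence "list_perm (xs @ a # y # ys) = list_perm ((xs @ [y]) @ a # ys) \<circ> ?t" by blast
  moreover have perm: "permutation (list_perm ((xs @ [y]) @ a # ys))"
    using Cons.prems by (intro list_perm_permutation) auto
  ultimately have "sign (list_perm (xs @ a # y # ys)) = - sign (list_perm ((xs @ [y]) @ a # ys))"
    using sign_compose[OF perm permutation_swap_id, of "Suc (length xs)" "Suc (Suc (length xs))"]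
    by (simp add: sign_swap_id)
  also have "sign (list_perm ((xs @ [y]) @ a # ys)) = (- 1) ^ length ys * sign (list_perm ((xs @ [y]) @ ys @ [a]))"
    using Cons.prems by (intro Cons.IH) auto
  finally show ?case by simp
qed simp

lemma sorted_list_of_set_insert_max:
  assumes "A \<subseteq> {1..n}"
  shows "sorted_list_of_set (insert (Suc n) A) = sorted_list_of_set A @ [Suc n]"
proof (rule sorted_distinct_set_unique)
  have "finite A" using assms finite_subset by blast
  thus "set (sorted_list_of_set (insert (Suc n) A)) = set (sorted_list_of_set A @ [Suc n])"
    "sorted (sorted_list_of_set A @ [Suc n])" "distinct (sorted_list_of_set A @ [Suc n])"
    using assms by (auto simp: sorted_append set_insort_key)
qed simp_all

lemma mui_perm_eq_list_perm:
  assumes "I \<subseteq> {1..n}"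
  shows "mui_perm n I = list_perm (sorted_list_of_set I @ sorted_list_of_set ({1..n} - I))"
proof -
  have "finite I" using assms finite_subset by blast
  hence "card I + card ({1..n} - I) = n"
    using assms card_mono[OF _ assms] by (simp add: card_Diff_subset)
  thus ?thesis by (auto simp: mui_perm_def list_perm_def fun_eq_iff)
qed

text \<open>Outside \<open>I\<close>, the new index comes last and is a fixed point; inside
  \<open>I\<close>, it precedes the \<open>n - card I\<close> indices of the complement.\<close>

lemma sign_mui_perm_Suc:
  assumes I: "I \<subseteq> {1..n}"
  shows "sign (mui_perm (Suc n) I) = sign (mui_perm n I)"
    and "sign (mui_perm (Suc n) (insert (Suc n) I)) = (- 1) ^ (n - card I) * sign (mui_perm n I)"
proof -
  let ?A = "sorted_list_of_set I" and ?B = "sorted_list_of_set ({1..n} - I)"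
  have fin: "finite I" using assms finite_subset by blast
  have card: "card I + card ({1..n} - I) = n"
    using fin assms card_mono[OF _ assms] by (simp add: card_Diff_subset)
  have last: "list_perm (?A @ ?B @ [Suc n]) = list_perm (?A @ ?B)"
    using card by (auto simp: list_perm_def fun_eq_iff nth_append le_Suc_eq)
  have "{1..Suc n} - I = insert (Suc n) ({1..n} - I)" using I by auto
  hence 1: "sorted_list_of_set ({1..Suc n} - I) = ?B @ [Suc n]"
    using sorted_list_of_set_insert_max[of "{1..n} - I" n] by simp
  have I': "I \<subseteq> {1..Suc n}" using I by auto
  show "sign (mui_perm (Suc n) I) = sign (mui_perm n I)"
    unfolding mui_perm_eq_list_perm[OF I] mui_perm_eq_list_perm[OF I'] 1 last ..
  have "{1..Suc n} - insert (Suc n) I = {1..n} - I" by auto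
  hence "sign (mui_perm (Suc n) (insert (Suc n) I)) = sign (list_perm (?A @ Suc n # ?B))"
    using I by (subst mui_perm_eq_list_perm) (auto simp: sorted_list_of_set_insert_max)
  also have "\<dots> = (- 1) ^ length ?B * sign (list_perm (?A @ ?B @ [Suc n]))"
    using I fin card by (intro sign_list_perm_move_last) auto
  also have "length ?B = n - card I" using card by simp
  finally show "sign (mui_perm (Suc n) (insert (Suc n) I)) = (- 1) ^ (n - card I) * sign (mui_perm n I)"
    unfolding last mui_perm_eq_list_perm[OF I] .
qed

section \<open>Laplace expansion of the determinants\<close>

lemma ext_const_hom:
  fixes a b :: "'a::comm_ring_1"
  shows ext_const_1: "ext_const (1 :: 'a) = 1"
    and ext_const_uminus: "ext_const (- a) = - ext_const a"
    and ext_const_add: "ext_const (a + b) = ext_const a + ext_const b"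
    and ext_const_mult: "ext_const (a * b) = ext_const a * ext_const b"
proof -
  show "ext_const (a * b) = ext_const a * ext_const b"
  proof (rule ext_eqI)
    fix K
    have "ext_coeff (ext_const a * ext_const b) K = (\<Sum>(I, J)\<in>splits K.
        shuffle_sign I J * (if I = {||} then a else 0) * (if J = {||} then b else 0))"
      by (simp add: times_ext.rep_eq ext_const_def ext_monom.rep_eq)
    also have "\<dots> = (if K = {||} then a * b else 0)"
      by (subst sum_splits_2) auto
    finally show "ext_coeff (ext_const (a * b)) K = ext_coeff (ext_const a * ext_const b) K"
      by (simp add: ext_const_def ext_monom.rep_eq)
  qed
qed (rule ext_eqI; simp add: ext_const_def ext_monom.rep_eq ext_coeff_1)+

lemma ext_const_hy_pol_power: "ext_const (hy_pol i ^ k) = hy i ^ k"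
  by (induction k) (simp_all add: ext_const_1 ext_const_mult hy_eq)

lemma sum_altsum: "(\<Sum>i\<in>A. altsum (f i) as) = altsum (\<lambda>a bs. \<Sum>i\<in>A. f i a bs) as"
  by (induction as arbitrary: f) (simp_all add: sum.distrib sum_distrib_left)

lemma mult_altsum: "c * altsum f as = altsum (\<lambda>a bs. c * f a bs) as"
  by (rule altsum_hom) (simp_all add: distrib_left)

definition mui_minor :: "nat list \<Rightarrow> nat list \<Rightarrow> 'p::prime_card pol" where
  "mui_minor rs as = det (mat (length as) (length as) (\<lambda>(u, v). hy_pol (rs ! u) ^ (CARD('p) ^ (as ! v))))"

lemma mui_minor_expand:
  assumes "length as = Suc (length rs)"
  shows "(mui_minor (rs @ [i]) as :: 'p::prime_card pol) =
    altsum (\<lambda>a bs. mui_minor rs bs * hy_pol i ^ (CARD('p) ^ a)) as"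
proof -
  let ?l = "length rs"
  define A :: "'p pol mat" where
    "A = mat (length as) (length as) (\<lambda>(u, v). hy_pol ((rs @ [i]) ! u) ^ (CARD('p) ^ (as ! v)))"
  have "det A = (\<Sum>j<Suc ?l. A $$ (?l, j) * cofactor A ?l j)"
    by (rule laplace_expansion_row) (auto simp: A_def assms)
  also have "\<dots> = (\<Sum>j<Suc ?l. (- 1) ^ (?l - j) *
      (mui_minor rs (take j as @ drop (Suc j) as) * hy_pol i ^ (CARD('p) ^ (as ! j))))"
  proof (intro sum.cong refl)
    fix j assume "j \<in> {..<Suc ?l}"
    hence j: "j \<le> ?l" by simp
    have "mat_delete A ?l j =
        mat ?l ?l (\<lambda>(u, v). hy_pol (rs ! u) ^ (CARD('p) ^ ((take j as @ drop (Suc j) as) ! v)))"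
      using j assms by (intro eq_matI) (auto simp: mat_delete_def A_def nth_append)
    moreover have "length (take j as @ drop (Suc j) as) = ?l" using j assms by simp
    ultimately have "det (mat_delete A ?l j) = mui_minor rs (take j as @ drop (Suc j) as)"
      unfolding mui_minor_def by metis
    \<comment> \<open>The cofactor sign has the same parity as the number of columns to the right of
      column \<open>j\<close>.\<close>
    moreover have "(- 1) ^ (?l + j) = ((- 1) ^ (?l - j) :: 'p pol)"
      using j by (simp add: minus_one_power_iff)
    moreover have "A $$ (?l, j) = hy_pol i ^ (CARD('p) ^ (as ! j))"
      using j assms by (simp add: A_def)
    ultimately show "A $$ (?l, j) * cofactor A ?l j = (- 1) ^ (?l - j) *
      (mui_minor rs (take j as @ drop (Suc j) as) * hy_pol i ^ (CARD('p) ^ (as ! j)))"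
      by (simp add: cofactor_def mult_ac)
  qed
  finally show ?thesis
    by (simp add: altsum_conv_sum assms mui_minor_def A_def)
qed

definition mui_term :: "nat \<Rightarrow> nat list \<Rightarrow> nat set \<Rightarrow> 'p::prime_card gca" where
  "mui_term n as I = of_int (sign (mui_perm n I)) * prod_list (map hx (sorted_list_of_set I)) *
     ext_const (mui_minor (sorted_list_of_set ({1..n} - I)) as)"

lemma mui_eq_sum_terms:
  "length as = n - k \<Longrightarrow> mui n k as = (\<Sum>I | I \<subseteq> {1..n} \<and> card I = k. mui_term n as I)"
  by (simp add: mui_def mui_term_def mui_minor_def)

lemma ext_const_central: "ext_const (a :: 'p::prime_card pol) * u = u * ext_const a"
proof (rule ext_eqI)
  fix K
  have "ext_coeff (ext_const a * u) K = a * ext_coeff u K"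
    unfolding times_ext.rep_eq by (subst sum_splits_1) (auto simp: ext_const_def ext_monom.rep_eq)
  moreover have "ext_coeff (u * ext_const a) K = ext_coeff u K * a"
    unfolding times_ext.rep_eq by (subst sum_splits_2) (auto simp: ext_const_def ext_monom.rep_eq)
  ultimately show "ext_coeff (ext_const a * u) K = ext_coeff (u * ext_const a) K" by simp
qed

text \<open>The last variable supplies the final odd factor, which commutes with the determinant;
  the sign is that of the permutation.\<close>

lemma mui_term_insert:
  assumes "I \<subseteq> {1..n}" "length as = n - card I"
  shows "mui_term (Suc n) as (insert (Suc n) I) = (- 1) ^ length as * (mui_term n as I * hx (Suc n))"
proof -
  have "{1..Suc n} - insert (Suc n) I = {1..n} - I" by auto
  thus ?thesis
    unfolding mui_term_def sign_mui_perm_Suc(2)[OF assms(1)] sorted_list_of_set_insert_max[OF assms(1)]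
    by (simp add: assms(2) mult.assoc ext_const_central)
qed

text \<open>The last variable labels the bottom row of the determinant, along which it is
  expanded.\<close>

lemma mui_term_expand:
  assumes I: "I \<subseteq> {1..n}" and "length as = Suc (n - card I)"
  shows "mui_term (Suc n) as I =
    altsum (\<lambda>a bs. mui_term n bs I * hy (Suc n) ^ (CARD('p) ^ a) :: 'p::prime_card gca) as"
proof -
  have "finite I" using I finite_subset by blast
  hence len: "length (sorted_list_of_set ({1..n} - I)) = n - card I"
    using I by (simp add: card_Diff_subset)
  have "{1..Suc n} - I = insert (Suc n) ({1..n} - I)" using I by auto
  hence 1: "sorted_list_of_set ({1..Suc n} - I) = sorted_list_of_set ({1..n} - I) @ [Suc n]"
    using sorted_list_of_set_insert_max[of "{1..n} - I" n] by simp
  have "ext_const (altsum f as) = altsum (\<lambda>a bs. ext_const (f a bs :: 'p pol)) as" for f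
    by (rule altsum_hom) (simp_all add: ext_const_add ext_const_uminus)
  thus ?thesis
    unfolding mui_term_def sign_mui_perm_Suc(1)[OF I] 1
    using len assms(2)
    by (simp add: mui_minor_expand ext_const_mult ext_const_hy_pol_power mult_altsum mult.assoc)
qed

text \<open>The subsets \<open>I\<close> are sorted by whether they contain the last index: those
  that do give the \<open>x\<close> term, the others the alternating sum.\<close>

lemma mui_eq_mui_rec:
  assumes "k \<le> n" "length as = n - k"
  shows "mui n k as = (mui_rec n as :: 'p::prime_card gca)"
  using assms
proof (induction n arbitrary: k as)
  case 0
  have "{I. I \<subseteq> {1..0 :: nat} \<and> card I = 0} = {{}}" by auto
  moreover have "mui_perm 0 {} = id" by (auto simp: mui_perm_def fun_eq_iff)
  ultimately show ?case using 0
    by (simp add: mui_eq_sum_terms mui_term_def mui_minor_def ext_const_1 sign_id)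
next
  case (Suc n)
  let ?A = "{I. I \<subseteq> {1..n} \<and> card I = k}" and ?B = "{I. I \<subseteq> {1..n} \<and> Suc (card I) = k}"
  have fin: "finite ?A" "finite ?B" by (rule finite_subset[of _ "Pow {1..n}"]; auto)+
  have fI: "finite I" if "I \<subseteq> {1..n}" for I using that finite_subset by blast
  have N: "Suc n \<notin> I" if "I \<subseteq> {1..n}" for I using that by auto
  have split: "{I. I \<subseteq> {1..Suc n} \<and> card I = k} = ?A \<union> insert (Suc n) ` ?B"
  proof (intro equalityI subsetI)
    fix I assume I: "I \<in> {I. I \<subseteq> {1..Suc n} \<and> card I = k}"
    show "I \<in> ?A \<union> insert (Suc n) ` ?B"
    proof (cases "Suc n \<in> I")
      case True
      have "finite I" using I finite_subset[of I "{1..Suc n}"] by auto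
      hence "Suc (card (I - {Suc n})) = card I" using True by (rule card_Suc_Diff1)
      hence "I - {Suc n} \<in> ?B" using I by (auto simp: le_Suc_eq)
      moreover have "I = insert (Suc n) (I - {Suc n})" using True by auto
      ultimately show ?thesis by blast
    next
      case False
      hence "I \<subseteq> {1..n}" using I by (auto simp: le_Suc_eq)
      thus ?thesis using I by auto
    qed
  next
    fix I assume "I \<in> ?A \<union> insert (Suc n) ` ?B"
    thus "I \<in> {I. I \<subseteq> {1..Suc n} \<and> card I = k}"
      using fI N by (auto simp: card_insert_if)
  qed
  have disj: "?A \<inter> insert (Suc n) ` ?B = {}" using N by blast
  have inj: "inj_on (insert (Suc n)) ?B"
  proof (rule inj_onI)
    fix I J assume "I \<in> ?B" "J \<in> ?B" "insert (Suc n) I = insert (Suc n) J"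
    moreover from this have "Suc n \<notin> I" "Suc n \<notin> J" using N by simp_all
    ultimately show "I = J" using insert_ident by metis
  qed
  have "mui (Suc n) k as = (\<Sum>I\<in>?A. mui_term (Suc n) as I) + (\<Sum>I\<in>insert (Suc n) ` ?B. mui_term (Suc n) as I :: 'p gca)"
    unfolding mui_eq_sum_terms[OF Suc.prems(2)] split
    by (rule sum.union_disjoint[OF fin(1) finite_imageI[OF fin(2)] disj])
  also have "(\<Sum>I\<in>insert (Suc n) ` ?B. mui_term (Suc n) as I :: 'p gca) = (\<Sum>I\<in>?B. mui_term (Suc n) as (insert (Suc n) I))"
    by (subst sum.reindex[OF inj]) (simp only: o_def)
  also have "\<dots> = (- 1) ^ length as * (mui_rec n as * hx (Suc n))"
  proof (cases k)
    case 0
    \<comment> \<open>Here \<open>?B\<close> is empty, and \<open>as\<close> has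
      \<open>Suc n\<close> entries, too many for \<open>mui_rec n\<close>.\<close>
    thus ?thesis using Suc.prems by (simp add: mui_rec_too_long)
  next
    case (Suc k')
    have "(\<Sum>I\<in>?B. mui_term (Suc n) as (insert (Suc n) I) :: 'p gca) =
        (\<Sum>I\<in>?B. (- 1) ^ length as * (mui_term n as I * hx (Suc n)))"
      using Suc.prems(2) Suc by (intro sum.cong refl mui_term_insert) auto
    also have "\<dots> = (- 1) ^ length as * ((\<Sum>I\<in>?B. mui_term n as I) * hx (Suc n))"
      by (simp only: sum_distrib_left sum_distrib_right)
    also have "(\<Sum>I\<in>?B. mui_term n as I) = mui n k' as"
      using Suc.prems(2) Suc by (simp add: mui_eq_sum_terms)
    also have "mui n k' as = (mui_rec n as :: 'p gca)"
      using Suc.prems Suc by (intro Suc.IH) auto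
    finally show ?thesis .
  qed
  also have "(\<Sum>I\<in>?A. mui_term (Suc n) as I) =
      altsum (\<lambda>a bs. mui_rec n bs * hy (Suc n) ^ (CARD('p) ^ a) :: 'p gca) as"
  proof (cases "k = Suc n")
    case True
    have "card I \<noteq> Suc n" if "I \<subseteq> {1..n}" for I using card_mono[OF _ that] by auto
    hence "?A = {}" using True by blast
    moreover have "as = []" using True Suc.prems(2) by simp
    ultimately show ?thesis by (simp only: sum.empty altsum.simps(1))
  next
    case False
    hence k: "k \<le> n" using Suc.prems(1) by simp
    have "(\<Sum>I\<in>?A. mui_term (Suc n) as I) =
        (\<Sum>I\<in>?A. altsum (\<lambda>a bs. mui_term n bs I * hy (Suc n) ^ (CARD('p) ^ a) :: 'p gca) as)"
      using Suc.prems(2) k by (intro sum.cong refl mui_term_expand) auto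
    also have "\<dots> = altsum (\<lambda>a bs. (\<Sum>I\<in>?A. mui_term n bs I) * hy (Suc n) ^ (CARD('p) ^ a)) as"
      by (simp add: sum_altsum sum_distrib_right)
    also have "\<dots> = altsum (\<lambda>a bs. mui_rec n bs * hy (Suc n) ^ (CARD('p) ^ a)) as"
    proof (rule altsum_cong)
      fix xs a ys assume "as = xs @ a # ys"
      hence "length (xs @ ys) = n - k" using Suc.prems(2) k by simp
      thus "(\<Sum>I\<in>?A. mui_term n (xs @ ys) I) * hy (Suc n) ^ (CARD('p) ^ a) =
          (mui_rec n (xs @ ys) * hy (Suc n) ^ (CARD('p) ^ a) :: 'p gca)"
        using Suc.IH[OF k, of "xs @ ys"] by (simp add: mui_eq_sum_terms)
    qed
    finally show ?thesis .
  qed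
  finally show ?case by (simp add: add.commute)
qed

section \<open>The Steenrod action on Mui invariants\<close>

lemma lookup_xi_exponent_image:
  assumes "inj_on e X" "finite X"
  shows "Poly_Mapping.lookup (xi_exponent q (e ` X) f) l = (\<Sum>i | i \<in> X \<and> f (e i) = Suc l. q ^ e i)"
proof -
  have "{a. a \<in> e ` X \<and> f a = Suc l} = e ` {i. i \<in> X \<and> f (e i) = Suc l}" by auto
  moreover have "inj_on e {i. i \<in> X \<and> f (e i) = Suc l}"
    using assms(1) by (rule inj_on_subset) auto
  ultimately show ?thesis
    using assms(2) by (simp add: lookup_xi_exponent sum.reindex)
qed

text \<open>Covering and disjointness of the blocks make the \<open>THE\<close> in
  \<open>Phi\<close> meaningful.\<close>

lemma Phi_eq_iff:
  assumes "ordered_decomp n k m J" "i \<in> {k+1..n}"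
  shows "Phi m J i = s \<longleftrightarrow> s \<le> m \<and> i \<in> J s"
proof -
  obtain r where r: "r \<le> m" "i \<in> J r"
    using assms unfolding ordered_decomp_def by blast
  have uniq: "r' = r" if "r' \<le> m" "i \<in> J r'" for r'
    using assms(1) r that unfolding ordered_decomp_def disjoint_family_on_def by blast
  have "Phi m J i = r"
    unfolding Phi_def using r uniq by blast
  thus ?thesis using r uniq by blast
qed

text \<open>Entry \<open>l\<close> belongs to the block \<open>J (Suc l)\<close>; the block
  \<open>J 0\<close> does not show. Beyond \<open>m\<close> both sides are 0, on the left as the
  default of \<open>nth_default\<close>.\<close>

lemma R_of_conv_xi_exponent:
  assumes J: "ordered_decomp n k m J" and e: "inj_on e {k+1..n}"
    and f: "\<And>i. i \<in> {k+1..n} \<Longrightarrow> f (e i) = Phi m J i"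
  shows "Poly_Mapping.nth (R_of q e m J) = xi_exponent q (e ` {k+1..n}) f"
proof (rule poly_mapping_eqI)
  fix l
  have iff: "f (e i) = Suc l \<longleftrightarrow> l < m \<and> i \<in> J (Suc l)" if "i \<in> {k+1..n}" for i
    unfolding f[OF that] Phi_eq_iff[OF J that] by (simp add: Suc_le_eq)
  have fibre: "{i. i \<in> {k+1..n} \<and> f (e i) = Suc l} = (if l < m then J (Suc l) else {})"
  proof (cases "l < m")
    case True
    have "J (Suc l) \<subseteq> {k+1..n}"
      using J True unfolding ordered_decomp_def by (metis Suc_leI UN_upper atMost_iff)
    moreover have "{i. i \<in> {k+1..n} \<and> f (e i) = Suc l} = {k+1..n} \<inter> J (Suc l)"
      using iff True by auto
    ultimately show ?thesis using True by (simp only: if_True Int_absorb1)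
  next
    case False
    thus ?thesis using iff by (simp only: if_False) blast
  qed
  show "Poly_Mapping.lookup (Poly_Mapping.nth (R_of q e m J)) l =
      Poly_Mapping.lookup (xi_exponent q (e ` {k+1..n}) f) l"
    unfolding lookup_xi_exponent_image[OF e finite_atLeastAtMost] fibre
    by (simp add: R_of_def nth_default_def del: upt_Suc)
qed

text \<open>The blocks are the fibres of \<open>i \<mapsto> f (e i)\<close>.\<close>

lemma xi_exponent_conv_R_of:
  assumes e: "inj_on e {k+1..n}" and "q > 0" and "length R = m"
    and R: "Poly_Mapping.nth R = xi_exponent q (e ` {k+1..n}) f"
  shows "\<exists>J. ordered_decomp n k m J \<and> R = R_of q e m J"
proof -
  define J where "J s = {i \<in> {k+1..n}. f (e i) = s}" for s
  have look: "nth_default 0 R l = (\<Sum>i | i \<in> {k+1..n} \<and> f (e i) = Suc l. q ^ e i)" for l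
    using arg_cong[OF R, of "\<lambda>r. Poly_Mapping.lookup r l"]
    unfolding lookup_xi_exponent_image[OF e finite_atLeastAtMost] by simp
  \<comment> \<open>A value above \<open>m\<close> would produce a nonzero entry beyond the end of
    \<open>R\<close>.\<close>
  have le: "f (e i) \<le> m" if i: "i \<in> {k+1..n}" for i
  proof (rule ccontr)
    assume "\<not> f (e i) \<le> m"
    then obtain l where l: "f (e i) = Suc l" "l \<ge> m" by (cases "f (e i)") auto
    have "q ^ e i \<le> (\<Sum>i | i \<in> {k+1..n} \<and> f (e i) = Suc l. q ^ e i)"
      using i l by (intro member_le_sum) auto
    moreover have "nth_default 0 R l = 0" using l assms(3) by (simp add: nth_default_def)
    moreover have "q ^ e i > 0" using assms(2) by simp
    ultimately show False unfolding look by linarith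
  qed
  have "ordered_decomp n k m J"
    using le by (auto simp: ordered_decomp_def J_def disjoint_family_on_def)
  moreover have "R = R_of q e m J"
  proof (rule nth_equalityI)
    fix l assume "l < length R"
    thus "R ! l = R_of q e m J ! l"
      using look[of l] assms(3) by (simp add: R_of_def J_def nth_default_def del: upt_Suc)
  qed (simp add: R_of_def assms(3))
  ultimately show ?thesis by blast
qed

lemma smul_minus_one_power: "smul ((- 1) ^ j) u = (- 1) ^ j * u"
proof -
  have "smul (- 1) v = - v" for v :: "'a gca"
    using smul_add_left[of "- 1" 1 v] by (simp add: eq_neg_iff_add_eq_0)
  thus ?thesis by (cases "even j") simp_all
qed

text \<open>The sign in the defining relation of the action is its own inverse.\<close>

lemma steenrod_act_eq_ct_coeff:
  assumes "homogeneous d (u :: 'p::prime_card gca)" "distinct S"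
  shows "St S R \<bullet>\<bullet> u = smul ((- 1) powi (int (length S) * (int d - int (length S))))
    (ct_coeff (coaction u) (fset_of_list S) (Poly_Mapping.nth R))"
proof -
  let ?s = "(- 1 :: 'p mod_ring) powi (int (length S) * (int d - int (length S)))"
  have 1: "ct_coeff (coaction u) (fset_of_list S) (Poly_Mapping.nth R) = smul ?s (St S R \<bullet>\<bullet> u)"
    by (rule coaction_eq_steenrod_act[OF hcomp_homogeneous[OF assms(1)] assms(2)])
  have 2: "?s * ?s = 1"
    by (rule power_int_minus_one_mult_self)
  show ?thesis unfolding 1 smul_smul 2 smul_1 ..
qed

theorem theorem1p1:
  fixes n k m :: nat and e :: "nat \<Rightarrow> nat" and S R :: "nat list"
  assumes "odd CARD('p::prime_card)"
    and "n \<ge> 1" and "k \<le> n" and "inj_on e {k+1..n}"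
    and "m \<ge> 1"
    and "sorted_wrt (<) S" and "\<forall>s\<in>set S. s < m"
    and "length R = m"
  shows "(\<forall>J. ordered_decomp n k m J \<and> R = R_of CARD('p) e m J \<longrightarrow>
            St S R \<bullet>\<bullet> (mui n k (map e [k+1..<n+1]) :: 'p gca) =
              (if length S \<le> k then
                 (- 1) ^ (length S * (k - length S)) *
                   mui n (k - length S) (S @ map (\<lambda>i. e i + Phi m J i) [k+1..<n+1])
               else 0)) \<and>
         ((\<nexists>J. ordered_decomp n k m J \<and> R = R_of CARD('p) e m J) \<longrightarrow>
            St S R \<bullet>\<bullet> (mui n k (map e [k+1..<n+1]) :: 'p gca) = 0)"
proof -
  let ?X = "{k+1..n}" and ?es = "map e [k+1..<n+1]" and ?q = "CARD('p)" and ?t = "length S"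
  let ?c = "ct_coeff (coaction (mui_rec n ?es :: 'p gca)) (fset_of_list S) (Poly_Mapping.nth R)"
  define w where "w = (\<Sum>a\<leftarrow>?es. ?q ^ a)"
  have upt: "set [k+1..<n+1] = ?X" by auto
  have set_es: "set ?es = e ` ?X" by (simp only: set_map upt)
  have dist: "distinct ?es" unfolding distinct_map upt using assms(4) by simp
  have mui: "mui n k ?es = (mui_rec n ?es :: 'p gca)"
    using assms(3) by (intro mui_eq_mui_rec) auto
  have hom: "homogeneous (k + 2 * w) (mui_rec n ?es :: 'p gca)"
  proof -
    have "length ?es = n - k" by (simp del: upt_Suc)
    hence "n + 2 * w - length ?es = k + 2 * w" using assms(3) by linarith
    thus ?thesis using homogeneous_mui_rec[of n ?es, where ?'p = 'p] unfolding w_def by metis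
  qed
  have "distinct S" using assms(6) strict_sorted_iff by blast
  hence act: "St S R \<bullet>\<bullet> (mui n k ?es :: 'p gca) =
      smul ((- 1) powi (int ?t * (int (k + 2 * w) - int ?t))) ?c"
    unfolding mui by (rule steenrod_act_eq_ct_coeff[OF hom])
  note coeff = ct_coeff_coaction_mui_rec[OF assms(1,6) dist, of "Poly_Mapping.nth R" n, unfolded set_es]
  show ?thesis
  proof (intro conjI allI impI)
    fix J assume J: "ordered_decomp n k m J \<and> R = R_of ?q e m J"
    \<comment> \<open>Transports \<open>Phi\<close> from indices to the values of \<open>e\<close>,
      using injectivity.\<close>
    define f where "f a = Phi m J (inv_into ?X e a)" for a
    have f: "f (e i) = Phi m J i" if "i \<in> ?X" for i
      using assms(4) that by (simp add: f_def)
    let ?es' = "map (\<lambda>i. e i + Phi m J i) [k+1..<n+1]"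
    have "Poly_Mapping.nth R = xi_exponent ?q (e ` ?X) f"
      using R_of_conv_xi_exponent[OF _ assms(4) f] J by simp
    hence "?c = mui_rec n (S @ map (\<lambda>a. a + f a) ?es)" using coeff by blast
    also have "map (\<lambda>a. a + f a) ?es = ?es'"
      unfolding map_map o_def using f by (intro map_cong refl) auto
    finally have c: "?c = mui_rec n (S @ ?es')" .
    show "St S R \<bullet>\<bullet> (mui n k ?es :: 'p gca) =
        (if ?t \<le> k then (- 1) ^ (?t * (k - ?t)) * mui n (k - ?t) (S @ ?es') else 0)"
    proof (cases "?t \<le> k")
      case True
      \<comment> \<open>The even part \<open>2 * w\<close> of the degree drops out of the sign, and
        for \<open>?t \<le> k\<close> the integer exponent is a natural number.\<close>
      hence diff: "int (k + 2 * w) - int ?t = int (k - ?t + 2 * w)" by simp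
      have "int ?t * (int (k + 2 * w) - int ?t) = int (?t * (k - ?t) + 2 * (?t * w))"
        unfolding diff of_nat_mult[symmetric] by (simp only: add_mult_distrib2 mult_ac)
      hence "(- 1 :: 'p mod_ring) powi (int ?t * (int (k + 2 * w) - int ?t)) = (- 1) ^ (?t * (k - ?t))"
        by (simp only: power_int_of_nat power_add power_mult) simp
      moreover have "mui_rec n (S @ ?es') = (mui n (k - ?t) (S @ ?es') :: 'p gca)"
        using True assms(3) by (intro mui_eq_mui_rec[symmetric]) (simp_all del: upt_Suc)
      ultimately show ?thesis
        unfolding act c using True by (simp only: smul_minus_one_power if_True)
    next
      case False
      \<comment> \<open>The list has \<open>?t + (n - k) > n\<close> entries.\<close>
      hence "mui_rec n (S @ ?es') = (0 :: 'p gca)"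
        using assms(3) by (intro mui_rec_too_long) (simp del: upt_Suc)
      thus ?thesis unfolding act c using False by simp
    qed
  next
    assume none: "\<nexists>J. ordered_decomp n k m J \<and> R = R_of ?q e m J"
    have "\<nexists>f. Poly_Mapping.nth R = xi_exponent ?q (e ` ?X) f"
      using xi_exponent_conv_R_of[OF assms(4) _ assms(8), of ?q] none by auto
    hence "?c = 0" using coeff by blast
    thus "St S R \<bullet>\<bullet> (mui n k ?es :: 'p gca) = 0" unfolding act by simp
  qed
qed

end
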